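(* There exists a constant $c>0$ such that any algorithm in the weak-strong oracle model (with corruption probability $\delta=1/3$) which outputs a spanning tree $T$ of an $n$-point metric space $(\mathcal{X},d)$ such that $\mathbb{E}[w(T)]\le c\sqrt{\log n}\cdot\min_{T'}w(T')$ must make at least $\Omega(n/\sqrt{\log n})$ strong oracle (point) queries. Moreover, this holds even when the weak oracle distances $\tilde d$ are restricted to form a metric on $\mathcal{X}$.
   Context: Weak-strong oracle model: unknown metric $d$ on $n$ points; independently for each unordered pair, with probability $\delta$ the pair is corrupted (randomness drawn once); the weak oracle returns $\tilde d(x,y)=d(x,y)$ for uncorrupted pairs and an arbitrary adversarially chosen value for corrupted pairs. A strong point query on $x$ returns a symbol from which, together with that of $y$, $d(x,y)$ can be computed. For a spanning tree $T$, $w(T)=\sum_{(x,y)\in T}d(x,y)$; the minimum is over all spanning trees $T'$. *)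

theory Defs
  imports "HOL-Probability.Probability"
begin

text \<open>
  The \<open>n\<close> points are named \<open>0, \<dots>, n - 1\<close>.  An unordered pair of distinct points
  is represented by the ordered pair whose first component is the smaller one.
\<close>

definition upairs :: "nat \<Rightarrow> (nat \<times> nat) set" where
  "upairs n = {(x, y). x < y \<and> y < n}"

definition adjacent :: "(nat \<times> nat) set \<Rightarrow> nat \<Rightarrow> nat \<Rightarrow> bool" where
  "adjacent T x y \<longleftrightarrow> (x, y) \<in> T \<or> (y, x) \<in> T"

definition connected_graph :: "nat \<Rightarrow> (nat \<times> nat) set \<Rightarrow> bool" where
  "connected_graph n T \<longleftrightarrow> (\<forall>x<n. \<forall>y<n. (adjacent T)\<^sup>*\<^sup>* x y)"

definition graph_cycle :: "(nat \<times> nat) set \<Rightarrow> nat list \<Rightarrow> bool" where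
  "graph_cycle T vs \<longleftrightarrow> 3 \<le> length vs \<and> distinct vs \<and>
     (\<forall>i<length vs. adjacent T (vs ! i) (vs ! (Suc i mod length vs)))"

definition spanning_tree :: "nat \<Rightarrow> (nat \<times> nat) set \<Rightarrow> bool" where
  "spanning_tree n T \<longleftrightarrow>
     T \<subseteq> upairs n \<and> connected_graph n T \<and> (\<nexists>vs. graph_cycle T vs)"

definition weight :: "(nat \<Rightarrow> nat \<Rightarrow> real) \<Rightarrow> (nat \<times> nat) set \<Rightarrow> real" where
  "weight d T = (\<Sum>(x, y)\<in>T. d x y)"

definition mst_weight :: "nat \<Rightarrow> (nat \<Rightarrow> nat \<Rightarrow> real) \<Rightarrow> real" where
  "mst_weight n d = Min (weight d ` {T. spanning_tree n T})"

text \<open>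
  The random corruption pattern: every unordered pair is corrupted independently with
  probability \<open>\<delta>\<close>.  It is drawn once, before the algorithm starts.
\<close>

definition corruption :: "real \<Rightarrow> nat \<Rightarrow> (nat \<times> nat \<Rightarrow> bool) pmf" where
  "corruption \<delta> n = Pi_pmf (upairs n) False (\<lambda>_. bernoulli_pmf \<delta>)"

text \<open>
  An instance consists of the hidden metric, the symbols returned by strong point queries,
  the function that computes a distance from two symbols, and the adversary, which chooses
  the values on the corrupted pairs and may do so depending on the whole corruption pattern.
\<close>

record ws_instance =
  metric :: "nat \<Rightarrow> nat \<Rightarrow> real"
  symbol :: "nat \<Rightarrow> nat"
  decode :: "nat \<Rightarrow> nat \<Rightarrow> real"
  adversary :: "(nat \<times> nat \<Rightarrow> bool) \<Rightarrow> (nat \<times> nat \<Rightarrow> real)"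

definition weak_dist :: "ws_instance \<Rightarrow> (nat \<times> nat \<Rightarrow> bool) \<Rightarrow> nat \<Rightarrow> nat \<Rightarrow> real" where
  "weak_dist I S x y =
     (let p = (min x y, max x y) in if S p then adversary I S p else metric I x y)"

definition instances :: "nat \<Rightarrow> ws_instance set" where
  "instances n = {I. Metric_space {..<n} (metric I) \<and>
     (\<forall>x<n. \<forall>y<n. decode I (symbol I x) (symbol I y) = metric I x y)}"

definition metric_weak_instances :: "real \<Rightarrow> nat \<Rightarrow> ws_instance set" where
  "metric_weak_instances \<delta> n = {I \<in> instances n.
     \<forall>S\<in>set_pmf (corruption \<delta> n). Metric_space {..<n} (weak_dist I S)}"

text \<open>
  Adaptive randomized algorithms as interaction trees.  A continuation receives the answer
  to the query, or the outcome of the internal random choice made in a \<open>Sample\<close> node.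
  Every branch is finite, but there is no bound on the depth.
\<close>

datatype alg =
    Output "(nat \<times> nat) set"
  | Weak nat nat "real \<Rightarrow> alg"
  | Strong nat "nat \<Rightarrow> alg"
  | Sample "nat pmf" "nat \<Rightarrow> alg"

text \<open>
  Joint distribution of the output and the number of strong queries, for fixed oracles.
\<close>

primrec run :: "(nat \<Rightarrow> nat \<Rightarrow> real) \<Rightarrow> (nat \<Rightarrow> nat) \<Rightarrow> alg \<Rightarrow> ((nat \<times> nat) set \<times> nat) pmf" where
  "run wk st (Output T) = return_pmf (T, 0)"
| "run wk st (Weak x y k) = run wk st (k (wk x y))"
| "run wk st (Strong x k) = map_pmf (\<lambda>(T, q). (T, Suc q)) (run wk st (k (st x)))"
| "run wk st (Sample p k) = bind_pmf p (\<lambda>i. run wk st (k i))"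

text \<open>
  An algorithm knows the decoding function, hence the argument of \<open>A\<close>; about the metric
  itself it learns only through its queries.
\<close>

definition outcome ::
    "real \<Rightarrow> nat \<Rightarrow> ((nat \<Rightarrow> nat \<Rightarrow> real) \<Rightarrow> alg) \<Rightarrow> ws_instance \<Rightarrow> ((nat \<times> nat) set \<times> nat) pmf" where
  "outcome \<delta> n A I =
     bind_pmf (corruption \<delta> n) (\<lambda>S. run (weak_dist I S) (symbol I) (A (decode I)))"

definition approximates_mst ::
    "real \<Rightarrow> nat \<Rightarrow> real \<Rightarrow> ((nat \<Rightarrow> nat \<Rightarrow> real) \<Rightarrow> alg) \<Rightarrow> ws_instance \<Rightarrow> bool" where
  "approximates_mst \<delta> n \<alpha> A I \<longleftrightarrow>
     (\<forall>(T, q)\<in>set_pmf (outcome \<delta> n A I). spanning_tree n T) \<and>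
     measure_pmf.expectation (outcome \<delta> n A I) (\<lambda>(T, q). weight (metric I) T)
       \<le> \<alpha> * mst_weight n (metric I)"

text \<open>
  Valued in the extended nonnegative reals, since the number of strong queries may have infinite expectation.
\<close>

definition expected_strong_queries ::
    "real \<Rightarrow> nat \<Rightarrow> ((nat \<Rightarrow> nat \<Rightarrow> real) \<Rightarrow> alg) \<Rightarrow> ws_instance \<Rightarrow> ennreal" where
  "expected_strong_queries \<delta> n A I =
     (\<integral>\<^sup>+ (T, q). ennreal (real q) \<partial>measure_pmf (outcome \<delta> n A I))"

text \<open>
  \<open>\<I> n\<close> is the class of \<open>n\<close>-point instances on which the algorithm has to succeed.
  The bound is on the worst instance of that class.
\<close>

definition strong_query_lower_bound ::
    "real \<Rightarrow> (nat \<Rightarrow> ws_instance set) \<Rightarrow> (nat \<Rightarrow> real) \<Rightarrow> (nat \<Rightarrow> real) \<Rightarrow> bool" where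
  "strong_query_lower_bound \<delta> \<I> \<alpha> f \<longleftrightarrow>
     (\<exists>C>0. \<forall>\<^sub>F n in sequentially. \<forall>A.
        (\<forall>I\<in>\<I> n. approximates_mst \<delta> n (\<alpha> n) A I) \<longrightarrow>
        (\<exists>I\<in>\<I> n. ennreal (C * f n) \<le> expected_strong_queries \<delta> n A I))"

end

theory Submission
  imports Defs "HOL-Real_Asymp.Real_Asymp"
begin

text \<open>
  Cut \<open>n\<close> positions into blocks of size \<open>m\<close>, about \<open>sqrt (ln n) / 2\<close>, place the points by a uniformly
  random permutation, and let the distance be \<open>1\<close> inside a block and \<open>m\<close> across blocks, so that a
  minimum spanning tree weighs \<open>O(n)\<close>.  Two given blocks have all \<open>m\<^sup>2\<close> pairs between them corrupted
  with probability at least \<open>1 / sqrt n\<close>, which suffices for a matching of fully corrupted pairs of blocks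
  that covers half of the blocks with high probability.  The adversary merges matched blocks: all
  distances inside a merged cluster are shown as \<open>1\<close>, and the weak distances form a metric.
  Corruption being invariant under permutations of the points, the weak distances tell nothing
  about how a cluster splits into its two blocks.  In a cluster without strong query, every
  point is therefore joined to a point of another block with probability at least \<open>1/2\<close>, whatever
  neighbour it gets in the tree.  If most clusters are not queried, the tree weighs
  \<open>\<Omega>(n m)\<close>, so \<open>\<Omega>(n / m)\<close> strong queries are necessary.
\<close>

section \<open>Two-level metrics and spanning trees\<close>

text \<open>The hidden metric and the weak distances are both of this form, for the groupings into
  blocks and into clusters; the grouping \<open>f\<close> is therefore a parameter.\<close>

definition two_level :: "real \<Rightarrow> (nat \<Rightarrow> 'a) \<Rightarrow> nat \<Rightarrow> nat \<Rightarrow> real" where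
  "two_level L f x y = (if x = y then 0 else if f x = f y then 1 else L)"

lemma two_level_commute: "two_level L f x y = two_level L f y x"
  by (auto simp: two_level_def)

text \<open>For the triangle inequality: if the end points lie in different groups, the middle point
  differs in group from one of them, so one leg already has length \<open>L\<close>.\<close>

lemma Metric_space_two_level:
  assumes "1 \<le> L"
  shows "Metric_space A (two_level L f)"
  using assms by unfold_locales (auto simp: two_level_def)

definition parent_tree :: "nat \<Rightarrow> (nat \<Rightarrow> nat) \<Rightarrow> (nat \<times> nat) set" where
  "parent_tree n par = (\<lambda>x. (par x, x)) ` {1..<n}"

lemma spanning_tree_parent_tree:
  assumes par: "\<And>x. 0 < x \<Longrightarrow> par x < x"
  shows "spanning_tree n (parent_tree n par)"
proof -
  let ?T = "parent_tree n par"
  have adj: "adjacent ?T x y \<longleftrightarrow> (0 < y \<and> y < n \<and> x = par y) \<or> (0 < x \<and> x < n \<and> y = par x)" for x y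
    by (auto simp: adjacent_def parent_tree_def image_iff)
  have sub: "?T \<subseteq> upairs n"
    using par by (auto simp: parent_tree_def upairs_def)
  have to_root: "(adjacent ?T)\<^sup>*\<^sup>* x 0 \<and> (adjacent ?T)\<^sup>*\<^sup>* 0 x" if "x < n" for x
    using that
  proof (induction x rule: less_induct)
    case (less x)
    show ?case
    proof (cases "x = 0")
      case False
      then have "par x < x" using par by simp
      with less have "(adjacent ?T)\<^sup>*\<^sup>* (par x) 0" "(adjacent ?T)\<^sup>*\<^sup>* 0 (par x)" by auto
      moreover have "adjacent ?T x (par x)" "adjacent ?T (par x) x"
        using False less.prems by (auto simp: adj)
      ultimately show ?thesis
        by (meson converse_rtranclp_into_rtranclp rtranclp.rtrancl_into_rtrancl)
    qed simp
  qed
  have conn: "connected_graph n ?T"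
    unfolding connected_graph_def using to_root by (meson rtranclp_trans)
  \<comment> \<open>On a cycle, both neighbours of the largest vertex would be its parent.\<close>
  have "False" if "graph_cycle ?T vs" for vs
  proof -
    define k where "k = length vs"
    have k: "3 \<le> k" and dist: "distinct vs"
      and edge: "\<And>i. i < k \<Longrightarrow> adjacent ?T (vs ! i) (vs ! (Suc i mod k))"
      using that by (auto simp: graph_cycle_def k_def)
    have "Max (set vs) \<in> set vs" using k by (intro Max_in) (auto simp: k_def)
    then obtain j where j: "j < k" "vs ! j = Max (set vs)"
      by (auto simp: in_set_conv_nth k_def)
    \<comment> \<open>\<open>i\<close> and \<open>l\<close> are the cyclic predecessor and successor
      of \<open>j\<close>; they differ because the cycle has length at least
      \<open>3\<close>.\<close>
    define i where "i = (j + k - 1) mod k"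
    define l where "l = Suc j mod k"
    have i: "i < k" "Suc i mod k = j" and l: "l < k"
      using k j by (auto simp: i_def l_def mod_Suc_eq)
    have il: "i = (if j = 0 then k - 1 else j - 1)" "l = (if Suc j = k then 0 else Suc j)"
      using j k by (auto simp: i_def l_def mod_if)
    then have ne: "i \<noteq> l" using k j by (auto split: if_splits)
    have le: "vs ! i' \<le> vs ! j" if "i' < k" for i'
      using that j by (simp add: k_def)
    have parent: "x = par (vs ! j)" if "adjacent ?T (vs ! j) x \<or> adjacent ?T x (vs ! j)" "x \<le> vs ! j" for x
      using that par by (auto simp: adj dest: leD)
    have "vs ! i = par (vs ! j)"
      using edge[OF i(1)] i le by (intro parent) auto
    moreover have "vs ! l = par (vs ! j)"
      using edge[OF j(1)] l le by (intro parent) (auto simp: l_def)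
    ultimately show False
      using ne i l dist nth_eq_iff_index_eq[of vs i l] by (auto simp: k_def)
  qed
  then show ?thesis
    using sub conn by (auto simp: spanning_tree_def)
qed

section \<open>Upper bound on the weight of a minimum spanning tree\<close>

lemma finite_upairs [simp]: "finite (upairs n)"
  by (rule finite_subset[of _ "{..<n} \<times> {..<n}"]) (auto simp: upairs_def)

lemma finite_spanning_trees [simp]: "finite {T. spanning_tree n T}"
  by (rule finite_subset[of _ "Pow (upairs n)"]) (auto simp: spanning_tree_def)

lemma mst_weight_le: "spanning_tree n T \<Longrightarrow> mst_weight n d \<le> weight d T"
  unfolding mst_weight_def by (intro Min_le) auto

text \<open>
  Every point hangs from the least point of its group, and these least points hang from \<open>0\<close>.
\<close>

lemma mst_weight_two_level_le:
  assumes L: "1 \<le> L" and f: "\<And>x. x < n \<Longrightarrow> f x \<le> (N::nat)"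
  shows "mst_weight n (two_level L f) \<le> real n + L * real (N + 1)"
proof -
  define rep where "rep x = (LEAST y. f y = f x)" for x
  have rep: "f (rep x) = f x" "rep x \<le> x" for x
    unfolding rep_def by (rule LeastI[of _ x]) (auto intro: Least_le)
  define par where "par x = (if rep x = x then 0 else rep x)" for x
  have par: "0 < x \<Longrightarrow> par x < x" for x
    using rep(2)[of x] by (auto simp: par_def)
  define R where "R = {x\<in>{1..<n}. rep x = x}"
  have "inj_on f R"
  proof (rule inj_onI)
    fix x y assume xy: "x \<in> R" "y \<in> R" "f x = f y"
    then have "rep x = rep y" by (simp only: rep_def)
    with xy show "x = y" by (simp add: R_def)
  qed
  moreover have "f ` R \<subseteq> {..N}"
    using f by (auto simp: R_def)
  ultimately have "card R \<le> card {..N}"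
    by (rule card_inj_on_le) simp
  then have cardR: "card R \<le> N + 1" by simp
  have "weight (two_level L f) (parent_tree n par) = (\<Sum>x\<in>{1..<n}. two_level L f (par x) x)"
    unfolding weight_def parent_tree_def by (subst sum.reindex) (auto simp: inj_on_def)
  \<comment> \<open>A point outside \<open>R\<close> hangs at distance \<open>1\<close> from the
    least point of its group; only points of \<open>R\<close>, at most one per group, can have an
    edge of length \<open>L\<close>.\<close>
  also have "\<dots> \<le> (\<Sum>x\<in>{1..<n}. 1 + L * of_bool (x \<in> R))"
    using L rep(1) by (intro sum_mono) (auto simp: two_level_def par_def R_def)
  also have "\<dots> = real (n - 1) + L * real (card R)"
  proof -
    have "{1..<n} \<inter> R = R" by (auto simp: R_def)
    then have "(\<Sum>x\<in>{1..<n}. of_bool (x \<in> R)) = real (card R)"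
      by (simp add: of_bool_def sum.If_cases)
    then show ?thesis by (simp add: sum.distrib flip: sum_distrib_left)
  qed
  also have "\<dots> \<le> real n + L * real (N + 1)"
    using L cardR by (intro add_mono mult_left_mono) auto
  finally show ?thesis
    using mst_weight_le[OF spanning_tree_parent_tree[of par n, OF par], of "two_level L f"] by linarith
qed

section \<open>Lower bound on the weight of a tree by its crossing points\<close>

definition neighbour :: "(nat \<times> nat) set \<Rightarrow> nat \<Rightarrow> nat" where
  "neighbour T x = (SOME y. adjacent T x y)"

lemma adjacent_neighbour:
  assumes "spanning_tree n T" "x < n" "2 \<le> n"
  shows "adjacent T x (neighbour T x)"
proof -
  obtain y where "y < n" "y \<noteq> x"
    using assms by (metis One_nat_def less_2_cases_iff less_le_trans zero_neq_one)
  then have "(adjacent T)\<^sup>*\<^sup>* x y"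
    using assms by (auto simp: spanning_tree_def connected_graph_def)
  then have "\<exists>z. adjacent T x z"
    using \<open>y \<noteq> x\<close> by (metis converse_rtranclpE)
  then show ?thesis
    unfolding neighbour_def by (rule someI_ex)
qed

lemma neighbour_bounds:
  assumes "spanning_tree n T" "x < n" "2 \<le> n"
  shows "neighbour T x < n" "neighbour T x \<noteq> x"
  using adjacent_neighbour[OF assms] assms(1)
  by (auto simp: adjacent_def spanning_tree_def upairs_def)

text \<open>Points are counted instead of edges, each with one neighbour chosen from the tree alone.
  Given the output, the pairs to be examined are thus fixed, however the points are grouped.\<close>

definition crossing :: "(nat \<Rightarrow> 'a) \<Rightarrow> nat \<Rightarrow> (nat \<times> nat) set \<Rightarrow> nat set" where
  "crossing f n T = {x. x < n \<and> f (neighbour T x) \<noteq> f x}"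

text \<open>Every crossing point is an end of a tree edge between groups. Such an edge has length
  \<open>L\<close> and only two ends, whence the factor \<open>2\<close>.\<close>

lemma crossing_le_weight:
  assumes T: "spanning_tree n T" and n: "2 \<le> n" and L: "0 \<le> L"
  shows "L * real (card (crossing f n T)) \<le> 2 * weight (two_level L f) T"
proof -
  define E where "E = {(x, y)\<in>T. f x \<noteq> f y}"
  have "finite T" using T finite_subset[OF _ finite_upairs] by (auto simp: spanning_tree_def)
  moreover have "E \<subseteq> T" by (auto simp: E_def)
  ultimately have finE: "finite E" "E \<subseteq> T" by (auto intro: finite_subset)
  have "crossing f n T \<subseteq> fst ` E \<union> snd ` E"
    using adjacent_neighbour[OF T _ n] by (force simp: crossing_def E_def adjacent_def image_iff)
  then have "card (crossing f n T) \<le> card (fst ` E \<union> snd ` E)"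
    using finE by (intro card_mono) auto
  also have "\<dots> \<le> 2 * card E"
    using card_Un_le[of "fst ` E" "snd ` E"] card_image_le[OF finE(1), of fst] card_image_le[OF finE(1), of snd]
    by linarith
  finally have "real (card (crossing f n T)) \<le> 2 * real (card E)" by linarith
  then have "L * real (card (crossing f n T)) \<le> L * (2 * real (card E))"
    using L by (rule mult_left_mono)
  also have "\<dots> = 2 * (\<Sum>e\<in>E. L)" by simp
  also have "(\<Sum>e\<in>E. L) \<le> weight (two_level L f) T"
  proof -
    have "(\<Sum>e\<in>E. L) = (\<Sum>(x, y)\<in>E. two_level L f x y)"
      by (intro sum.cong) (auto simp: E_def two_level_def)
    also have "\<dots> \<le> (\<Sum>(x, y)\<in>T. two_level L f x y)"
      using finE \<open>finite T\<close> L by (intro sum_mono2) (auto simp: two_level_def)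
    finally show ?thesis by (simp add: weight_def)
  qed
  finally show ?thesis by simp
qed

section \<open>Corruption patterns\<close>

lemma prob_pair_pmf_Times:
  "measure_pmf.prob (pair_pmf p q) (A \<times> B) = measure_pmf.prob p A * measure_pmf.prob q B"
proof -
  have "emeasure (pair_pmf p q) (A \<times> B) = (\<integral>\<^sup>+x. indicator A x * emeasure q B \<partial>p)"
    by (simp add: nn_integral_pair_pmf' indicator_times nn_integral_cmult flip: nn_integral_indicator)
  also have "\<dots> = emeasure p A * emeasure q B"
    by (simp add: nn_integral_multc)
  finally show ?thesis
    by (simp add: measure_def enn2real_mult)
qed

text \<open>Events on disjoint sets of coordinates are independent. The induction splits the product
  distribution at \<open>D e\<close>, and the other sets live on \<open>A - D e\<close>; so
  \<open>A\<close> has to vary.\<close>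

lemma measure_Pi_pmf_disjoint_blocks:
  assumes "finite F" "finite A" "\<And>e. e \<in> F \<Longrightarrow> D e \<subseteq> A" "disjoint_family_on D F"
    and "0 \<le> p" "p \<le> 1"
  shows "measure_pmf.prob (Pi_pmf A False (\<lambda>_. bernoulli_pmf p)) {f. \<forall>e\<in>F. \<exists>a\<in>D e. \<not> f a}
    = (\<Prod>e\<in>F. 1 - p ^ card (D e))"
  using assms
proof (induction F arbitrary: A rule: finite_induct)
  case (insert e F)
  let ?P = "\<lambda>A. Pi_pmf A False (\<lambda>_. bernoulli_pmf p)"
  let ?B = "A - D e"
  have D: "D e \<subseteq> A" using insert.prems by auto
  then have fin: "finite (D e)" "finite ?B"
    using insert.prems(1) by (auto intro: finite_subset)
  have disj: "D e' \<inter> D e = {}" if "e' \<in> F" for e'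
    using insert.prems(3) insert.hyps(2) that by (auto simp: disjoint_family_on_def)
  have "?P A = map_pmf (\<lambda>(f, g) x. if x \<in> D e then f x else g x) (pair_pmf (?P (D e)) (?P ?B))"
    using Pi_pmf_union[of "D e" ?B False "\<lambda>_. bernoulli_pmf p"] fin D by (simp add: Un_absorb1)
  then have "measure_pmf.prob (?P A) {f. \<forall>e'\<in>insert e F. \<exists>a\<in>D e'. \<not> f a} =
    measure_pmf.prob (pair_pmf (?P (D e)) (?P ?B))
      ({f. \<exists>a\<in>D e. \<not> f a} \<times> {f. \<forall>e'\<in>F. \<exists>a\<in>D e'. \<not> f a})"
    using disj by (auto intro!: arg_cong[where f = "measure_pmf.prob _"] simp: vimage_def split: if_splits)
      (metis disjoint_iff)+
  also have "\<dots> = measure_pmf.prob (?P (D e)) {f. \<exists>a\<in>D e. \<not> f a} *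
      measure_pmf.prob (?P ?B) {f. \<forall>e'\<in>F. \<exists>a\<in>D e'. \<not> f a}"
    by (rule prob_pair_pmf_Times)
  also have "measure_pmf.prob (?P ?B) {f. \<forall>e'\<in>F. \<exists>a\<in>D e'. \<not> f a} = (\<Prod>e\<in>F. 1 - p ^ card (D e))"
  proof (rule insert.IH)
    show "D e' \<subseteq> ?B" if "e' \<in> F" for e'
      using disj[OF that] insert.prems(2) that by auto
    show "disjoint_family_on D F"
      using insert.prems(3) by (auto simp: disjoint_family_on_def)
  qed (use fin insert.prems in auto)
  also have "measure_pmf.prob (?P (D e)) {f. \<exists>a\<in>D e. \<not> f a} = 1 - p ^ card (D e)"
  proof -
    have "{f. \<exists>a\<in>D e. \<not> f a} = - (Pi (D e) (\<lambda>_. {True}))" by (auto simp: Pi_def)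
    then have "measure_pmf.prob (?P (D e)) {f. \<exists>a\<in>D e. \<not> f a} =
        1 - measure_pmf.prob (?P (D e)) (Pi (D e) (\<lambda>_. {True}))"
      using measure_pmf.prob_compl[of "Pi (D e) (\<lambda>_. {True})" "?P (D e)"] by (simp add: Compl_eq_Diff_UNIV)
    also have "measure_pmf.prob (?P (D e)) (Pi (D e) (\<lambda>_. {True})) =
        (\<Prod>x\<in>D e. measure_pmf.prob (bernoulli_pmf p) {True})"
      using fin by (intro measure_Pi_pmf_Pi) auto
    finally show ?thesis
      using \<open>0 \<le> p\<close> \<open>p \<le> 1\<close> by (simp add: measure_pmf_single)
  qed
  finally show ?case using insert.hyps by simp
qed simp

section \<open>Invariance of the corruption pattern under permutations of the points\<close>

definition relabel :: "nat \<Rightarrow> (nat \<Rightarrow> nat) \<Rightarrow> nat \<times> nat \<Rightarrow> nat \<times> nat" where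
  "relabel n \<sigma> = (\<lambda>(x, y). if (x, y) \<in> upairs n then (min (\<sigma> x) (\<sigma> y), max (\<sigma> x) (\<sigma> y)) else (x, y))"

lemma relabel_in_upairs:
  assumes "\<sigma> permutes {..<n}" "e \<in> upairs n"
  shows "relabel n \<sigma> e \<in> upairs n"
proof -
  obtain x y where e: "e = (x, y)" "x < y" "y < n" using assms by (auto simp: upairs_def)
  have "\<sigma> x \<noteq> \<sigma> y" using permutes_inj[OF assms(1)] e by (metis injD less_irrefl)
  moreover have "\<sigma> x < n" "\<sigma> y < n" using permutes_in_image[OF assms(1)] e by auto
  ultimately show ?thesis using e assms(2) by (auto simp: relabel_def upairs_def)
qed

lemma relabel_relabel:
  assumes \<sigma>: "\<sigma> permutes {..<n}" and \<tau>: "\<And>x. \<tau> (\<sigma> x) = x"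
  shows "relabel n \<tau> (relabel n \<sigma> e) = e"
proof (cases "e \<in> upairs n")
  case True
  then obtain x y where e: "e = (x, y)" "x < y" "y < n" by (auto simp: upairs_def)
  have "relabel n \<sigma> e \<in> upairs n" using relabel_in_upairs[OF \<sigma> True] .
  then show ?thesis using e True \<tau> by (auto simp: relabel_def min_def max_def split: if_splits)
qed (cases e; simp add: relabel_def)

text \<open>All pairs have the same corruption probability and \<open>relabel n \<sigma>\<close>
  permutes them. Outside \<open>upairs n\<close> it is the identity, so the coordinates with the
  default value \<open>False\<close> stay there.\<close>

lemma corruption_relabel:
  assumes "\<sigma> permutes {..<n}"
  shows "corruption \<delta> n = map_pmf (\<lambda>S. S \<circ> relabel n \<sigma>) (corruption \<delta> n)"
  unfolding corruption_def
proof (rule Pi_pmf_bij_betw)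
  have inv: "inv \<sigma> permutes {..<n}" using permutes_inv[OF assms] .
  show "bij_betw (relabel n \<sigma>) (upairs n) (upairs n)"
    by (rule bij_betw_byWitness[of _ "relabel n (inv \<sigma>)"])
       (use relabel_in_upairs[OF assms] relabel_in_upairs[OF inv]
          relabel_relabel[OF assms, of "inv \<sigma>"] relabel_relabel[OF inv, of \<sigma>] permutes_inverses[OF assms] in auto)
  show "relabel n \<sigma> e \<notin> upairs n" if "e \<notin> upairs n" for e
    using that by (cases e) (simp add: relabel_def)
qed simp

section \<open>Query traces\<close>

text \<open>The bare number of strong queries does not tell which clusters were left untouched, so
  the queried points are recorded.\<close>

primrec run_trace :: "(nat \<Rightarrow> nat \<Rightarrow> real) \<Rightarrow> (nat \<Rightarrow> nat) \<Rightarrow> alg \<Rightarrow> ((nat \<times> nat) set \<times> nat list) pmf" where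
  "run_trace wk st (Output T) = return_pmf (T, [])"
| "run_trace wk st (Weak x y k) = run_trace wk st (k (wk x y))"
| "run_trace wk st (Strong x k) = map_pmf (\<lambda>(T, l). (T, x # l)) (run_trace wk st (k (st x)))"
| "run_trace wk st (Sample p k) = bind_pmf p (\<lambda>i. run_trace wk st (k i))"

lemma run_conv_run_trace: "run wk st a = map_pmf (\<lambda>(T, l). (T, length l)) (run_trace wk st a)"
  by (induction a)
     (auto simp: map_pmf_comp map_bind_pmf split_def intro!: bind_pmf_cong map_pmf_cong)

text \<open>As long as no point of \<open>C\<close> is queried, both runs receive the same answers;
  as soon as one is, both integrands vanish. The weight \<open>f\<close> is general in the induction
  because a query \<open>x\<close> turns it into \<open>f T (x # l)\<close>.\<close>

lemma run_trace_indistinguishable: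
  fixes f :: "(nat \<times> nat) set \<Rightarrow> nat list \<Rightarrow> ennreal"
  assumes "\<And>x. x \<notin> C \<Longrightarrow> st x = st' x"
  shows "(\<integral>\<^sup>+ (T, l). f T l * of_bool (set l \<inter> C = {}) \<partial>run_trace wk st a) =
    (\<integral>\<^sup>+ (T, l). f T l * of_bool (set l \<inter> C = {}) \<partial>run_trace wk st' a)"
proof (induction a arbitrary: f)
  case (Strong x k)
  show ?case
  proof (cases "x \<in> C")
    case False
    then have "st x = st' x" "\<And>l. set (x # l) \<inter> C = {} \<longleftrightarrow> set l \<inter> C = {}" using assms by auto
    then show ?thesis
      using Strong.IH[of _ "\<lambda>T l. f T (x # l)"] by (simp add: split_def)
  qed (simp add: split_def)
qed (simp_all add: nn_integral_bind_pmf)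

text \<open>In each orbit of \<open>\<iota>\<close> all elements have the same weight and at least
  one satisfies \<open>Q\<close>, so \<open>Q\<close> carries at least half of the total
  weight.\<close>

lemma sum_involution_le:
  fixes a :: "'a \<Rightarrow> ennreal"
  assumes fin: "finite P" and \<iota>: "\<And>s. s \<in> P \<Longrightarrow> \<iota> s \<in> P" "\<And>s. s \<in> P \<Longrightarrow> \<iota> (\<iota> s) = s"
    and a: "\<And>s. s \<in> P \<Longrightarrow> a (\<iota> s) = a s"
    and Q: "\<And>s. s \<in> P \<Longrightarrow> Q s \<or> Q (\<iota> s)"
  shows "(\<Sum>s\<in>P. a s) \<le> 2 * (\<Sum>s\<in>P. a s * of_bool (Q s))"
proof -
  have "bij_betw \<iota> P P"
    by (rule bij_betw_byWitness[of _ \<iota>]) (use \<iota> in auto)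
  then have "(\<Sum>s\<in>P. a (\<iota> s) * of_bool (Q (\<iota> s))) = (\<Sum>s\<in>P. a s * of_bool (Q s))"
    by (rule sum.reindex_bij_betw)
  then have "2 * (\<Sum>s\<in>P. a s * of_bool (Q s)) =
      (\<Sum>s\<in>P. a s * of_bool (Q s)) + (\<Sum>s\<in>P. a (\<iota> s) * of_bool (Q (\<iota> s)))"
    by (simp add: mult_2)
  also have "\<dots> = (\<Sum>s\<in>P. a s * of_bool (Q s) + a (\<iota> s) * of_bool (Q (\<iota> s)))"
    by (simp add: sum.distrib)
  also have "\<dots> \<ge> (\<Sum>s\<in>P. a s)"
    using Q by (intro sum_mono) (auto simp: a)
  finally show ?thesis .
qed

section \<open>Matchings of fully corrupted blocks\<close>

text \<open>Block \<open>g\<close> consists of the positions \<open>p\<close> with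
  \<open>p div m = g\<close>. A matching is encoded as a total involution whose fixed points are the
  unmatched blocks.\<close>

definition block_matching :: "nat \<Rightarrow> nat \<Rightarrow> (nat \<times> nat \<Rightarrow> bool) \<Rightarrow> (nat \<Rightarrow> nat) \<Rightarrow> bool" where
  "block_matching m N S \<pi> \<longleftrightarrow> (\<forall>g. \<pi> (\<pi> g) = g) \<and> (\<forall>g\<ge>N. \<pi> g = g) \<and>
     (\<forall>p q. p < q \<longrightarrow> q < N * m \<longrightarrow> p div m \<noteq> q div m \<longrightarrow> \<pi> (p div m) = q div m \<longrightarrow> S (p, q))"

definition matched :: "nat \<Rightarrow> (nat \<Rightarrow> nat) \<Rightarrow> nat set" where
  "matched N \<pi> = {g. g < N \<and> \<pi> g \<noteq> g}"

lemma finite_matched [simp]: "finite (matched N \<pi>)"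
  by (simp add: matched_def)

text \<open>A block that is not matched is its own mate.\<close>

definition mate :: "nat \<Rightarrow> nat \<Rightarrow> (nat \<times> nat \<Rightarrow> bool) \<Rightarrow> nat \<Rightarrow> nat" where
  "mate m N S = (SOME \<pi>. block_matching m N S \<pi> \<and>
     (\<forall>\<rho>. block_matching m N S \<rho> \<longrightarrow> card (matched N \<rho>) \<le> card (matched N \<pi>)))"

text \<open>A largest matching exists: \<open>id\<close> is a matching, and no matching covers more
  than \<open>N\<close> blocks.\<close>

lemma mate:
  shows mate_matching: "block_matching m N S (mate m N S)"
    and mate_maximal: "block_matching m N S \<rho> \<Longrightarrow> card (matched N \<rho>) \<le> card (matched N (mate m N S))"
proof -
  have "block_matching m N S id"
    by (auto simp: block_matching_def)
  moreover have "\<forall>\<pi>. block_matching m N S \<pi> \<longrightarrow> card (matched N \<pi>) < Suc N"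
  proof (intro allI impI)
    fix \<pi> :: "nat \<Rightarrow> nat"
    have "card (matched N \<pi>) \<le> card {..<N}"
      by (rule card_mono) (auto simp: matched_def)
    then show "card (matched N \<pi>) < Suc N" by simp
  qed
  ultimately have "\<exists>\<pi>. block_matching m N S \<pi> \<and>
      (\<forall>\<rho>. block_matching m N S \<rho> \<longrightarrow> card (matched N \<rho>) \<le> card (matched N \<pi>))"
    by (rule ex_has_greatest_nat)
  from someI_ex[OF this] show "block_matching m N S (mate m N S)"
    and "block_matching m N S \<rho> \<Longrightarrow> card (matched N \<rho>) \<le> card (matched N (mate m N S))"
    unfolding mate_def by blast+
qed

lemma mate_mate [simp]: "mate m N S (mate m N S g) = g"
  and mate_ge [simp]: "N \<le> g \<Longrightarrow> mate m N S g = g"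
  using mate_matching[of m N S] by (auto simp: block_matching_def)

lemma mate_corrupted:
  assumes "p < q" "q < N * m" "p div m \<noteq> q div m" "mate m N S (p div m) = q div m"
  shows "S (p, q)"
  using mate_matching[of m N S] assms by (auto simp: block_matching_def)

lemma mate_less: "g < N \<Longrightarrow> mate m N S g < N"
  by (metis linorder_not_less mate_ge mate_mate)

definition block_pair :: "nat \<Rightarrow> nat \<times> nat \<Rightarrow> (nat \<times> nat) set" where
  "block_pair m = (\<lambda>(g, h). {g * m..<Suc g * m} \<times> {h * m..<Suc h * m})"

lemma mem_block_iff: "0 < m \<Longrightarrow> p \<in> {g * m..<Suc g * m} \<longleftrightarrow> p div m = (g::nat)"
  by (auto simp: div_nat_eqI mult.commute dividend_less_times_div less_mult_imp_div_less)

lemma mem_block_pair_iff: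
  "0 < m \<Longrightarrow> (p, q) \<in> block_pair m (g, h) \<longleftrightarrow> p div m = g \<and> q div m = h"
  by (simp add: block_pair_def mem_block_iff del: atLeastLessThan_iff mult_Suc)

lemma card_block_pair: "card (block_pair m e) = m\<^sup>2"
  by (cases e) (simp add: block_pair_def card_cartesian_product power2_eq_square)

text \<open>If all pairs between two unmatched blocks were corrupted, these blocks could be matched
  to each other, contradicting maximality.\<close>

lemma unmatched_not_corrupted:
  assumes m: "0 < m" and gh: "g < h" "h < N"
    and un: "g \<notin> matched N (mate m N S)" "h \<notin> matched N (mate m N S)"
  shows "\<exists>e\<in>block_pair m (g, h). \<not> S e"
proof (rule ccontr)
  assume *: "\<not> (\<exists>e\<in>block_pair m (g, h). \<not> S e)"
  define \<pi> where "\<pi> = mate m N S"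
  define \<rho> where "\<rho> = \<pi>(g := h, h := g)"
  have fixp: "\<pi> g = g" "\<pi> h = h"
    using un gh by (auto simp: matched_def \<pi>_def)
  have inv: "\<pi> (\<pi> x) = x" for x by (simp add: \<pi>_def)
  have ne: "\<pi> x \<noteq> g" "\<pi> x \<noteq> h" if "x \<noteq> g" "x \<noteq> h" for x
    using that fixp inv by metis+
  have "\<rho> (\<rho> x) = x" for x
    using inv ne gh by (auto simp: \<rho>_def)
  moreover have "\<rho> x = x" if "N \<le> x" for x
    using that gh by (auto simp: \<rho>_def \<pi>_def)
  moreover have "S (p, q)"
    if pq: "p < q" "q < N * m" "p div m \<noteq> q div m" "\<rho> (p div m) = q div m" for p q
  proof -
    have le: "p div m \<le> q div m" using pq by (intro div_le_mono) simp
    show ?thesis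
    proof (cases "p div m = g \<or> p div m = h")
      case True
      \<comment> \<open>Since \<open>p < q\<close>, the smaller block \<open>g\<close> contains
        \<open>p\<close>; this is the orientation used in
        \<open>block_pair m (g, h)\<close>.\<close>
      with le pq gh have "p div m = g" "q div m = h" by (auto simp: \<rho>_def split: if_splits)
      then show ?thesis using * m by (auto simp: mem_block_pair_iff)
    next
      case False
      then show ?thesis using pq mate_corrupted[of p q N m S] by (auto simp: \<rho>_def \<pi>_def)
    qed
  qed
  ultimately have "block_matching m N S \<rho>"
    unfolding block_matching_def by blast
  then have "card (matched N \<rho>) \<le> card (matched N \<pi>)"
    unfolding \<pi>_def by (rule mate_maximal)
  moreover have "matched N \<pi> \<subset> matched N \<rho>"
    using gh fixp by (auto simp: matched_def \<rho>_def)
  ultimately show False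
    using psubset_card_mono[of "matched N \<rho>" "matched N \<pi>"] by simp
qed

lemma card_ordered_pairs:
  assumes "finite (U :: nat set)"
  shows "2 * card {(g, h). g \<in> U \<and> h \<in> U \<and> g < h} + card U = (card U)\<^sup>2"
proof -
  let ?A = "{(g, h). g \<in> U \<and> h \<in> U \<and> g < h}"
  let ?B = "(\<lambda>(g, h). (h, g)) ` ?A" and ?C = "(\<lambda>g. (g, g)) ` U"
  have fin: "finite ?A" by (rule finite_subset[of _ "U \<times> U"]) (use assms in auto)
  have "U \<times> U = ?A \<union> ?B \<union> ?C" by (auto simp: image_iff)
  then have "(card U)\<^sup>2 = card (?A \<union> ?B \<union> ?C)"
    by (metis card_cartesian_product power2_eq_square)
  also have "\<dots> = card ?A + card ?B + card ?C"
    using fin assms by (subst card_Un_disjoint; (subst card_Un_disjoint)?) auto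
  also have "card ?B = card ?A" by (intro card_image) (auto simp: inj_on_def)
  also have "card ?C = card U" by (intro card_image) (auto simp: inj_on_def)
  finally show ?thesis by simp
qed

text \<open>
  The unmatched blocks of a maximal matching contain no fully corrupted pair of blocks; the bound is
  a union bound over all sets of more than half of the blocks.
\<close>

lemma prob_few_matched_le:
  assumes m: "0 < m" and \<delta>: "0 \<le> \<delta>" "\<delta> \<le> 1" and Nm: "N * m \<le> n"
  shows "measure_pmf.prob (corruption \<delta> n) {S. 2 * card (matched N (mate m N S)) < N}
    \<le> exp (real N - \<delta> ^ m\<^sup>2 * (real N ^ 2 - 1) / 8)"
proof -
  define E where "E U = {(g, h). g \<in> U \<and> h \<in> U \<and> g < (h::nat)}" for U
  define \<U> where "\<U> = {U. U \<subseteq> {..<N} \<and> N < 2 * card U}"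
  define bad where "bad U = {S. \<forall>e\<in>E U. \<exists>a\<in>block_pair m e. \<not> S a}" for U
  define x where "x = \<delta> ^ m\<^sup>2"
  have x: "0 \<le> x" "x \<le> 1" using \<delta> by (auto simp: x_def power_le_one)
  have fin\<U>: "finite \<U>" "card \<U> \<le> 2 ^ N"
    using card_mono[of "Pow {..<N}" \<U>] finite_subset[of \<U> "Pow {..<N}"] by (auto simp: \<U>_def card_Pow)
  have "{S. 2 * card (matched N (mate m N S)) < N} \<subseteq> (\<Union>U\<in>\<U>. bad U)"
  proof
    fix S assume "S \<in> {S. 2 * card (matched N (mate m N S)) < N}"
    then have few: "2 * card (matched N (mate m N S)) < N" by simp
    let ?U = "{..<N} - matched N (mate m N S)"
    have "card ?U = N - card (matched N (mate m N S))"
      by (subst card_Diff_subset) (auto simp: matched_def)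
    then have "?U \<in> \<U>" using few by (auto simp: \<U>_def)
    moreover have "S \<in> bad ?U"
      using unmatched_not_corrupted[OF m] by (auto simp: bad_def E_def)
    ultimately show "S \<in> (\<Union>U\<in>\<U>. bad U)" by blast
  qed
  then have "measure_pmf.prob (corruption \<delta> n) {S. 2 * card (matched N (mate m N S)) < N} \<le>
      measure_pmf.prob (corruption \<delta> n) (\<Union>U\<in>\<U>. bad U)"
    by (intro measure_pmf.finite_measure_mono) auto
  also have "\<dots> \<le> (\<Sum>U\<in>\<U>. measure_pmf.prob (corruption \<delta> n) (bad U))"
    using fin\<U> by (intro measure_pmf.finite_measure_subadditive_finite) auto
  also have "\<dots> \<le> (\<Sum>U\<in>\<U>. exp (- x * (real N ^ 2 - 1) / 8))"
  proof (rule sum_mono)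
    fix U assume "U \<in> \<U>"
    then have U: "U \<subseteq> {..<N}" "N < 2 * card U" "finite U"
      by (auto simp: \<U>_def intro: finite_subset)
    have finE: "finite (E U)" by (rule finite_subset[of _ "U \<times> U"]) (use U in \<open>auto simp: E_def\<close>)
    have "block_pair m e \<subseteq> upairs n" if "e \<in> E U" for e
    proof
      fix a assume a: "a \<in> block_pair m e"
      obtain g h p q where *: "e = (g, h)" "a = (p, q)" by (cases e, cases a) auto
      then have "p div m = g" "q div m = h" "g < h" "h < N"
        using a m that U by (auto simp: E_def mem_block_pair_iff)
      then have "p div m < q div m" "q div m < N" by auto
      moreover from this have "\<not> q \<le> p"
        using div_le_mono[of q p m] by linarith
      ultimately have "p < q" "q < N * m"
        using m by (simp_all flip: div_less_iff_less_mult)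
      then show "a \<in> upairs n" using * Nm by (auto simp: upairs_def)
    qed
    moreover have "disjoint_family_on (block_pair m) (E U)"
      using m by (auto simp: disjoint_family_on_def mem_block_pair_iff)
    ultimately have "measure_pmf.prob (corruption \<delta> n) (bad U) = (1 - x) ^ card (E U)"
      unfolding corruption_def bad_def x_def using finE \<delta>
      by (subst measure_Pi_pmf_disjoint_blocks) (auto simp: card_block_pair)
    also have "\<dots> \<le> exp (- x) ^ card (E U)"
      using x exp_ge_add_one_self[of "- x"] by (intro power_mono) auto
    also have "\<dots> = exp (- x * real (card (E U)))"
      using exp_of_nat_mult[of "card (E U)" "- x"] by (simp add: mult.commute)
    also have "\<dots> \<le> exp (- x * (real N ^ 2 - 1) / 8)"
    proof -
      have "2 * card (E U) + card U = (card U)\<^sup>2"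
        using card_ordered_pairs[OF U(3)] by (simp add: E_def)
      then have eq: "2 * real (card (E U)) + real (card U) = (real (card U))\<^sup>2"
        by (metis of_nat_add of_nat_mult of_nat_numeral of_nat_power)
      \<comment> \<open>With \<open>u = card U\<close>, there are \<open>u * (u - 1) / 2\<close>
        pairs of blocks, and eight times this plus one is \<open>(2 * u - 1)^2\<close>, which is at
        least \<open>N^2\<close>. This gives the \<open>(N^2 - 1) / 8\<close> of the bound.\<close>
      have "real N + 1 \<le> 2 * real (card U)" using U(2) by linarith
      then have "(real N)\<^sup>2 \<le> (2 * real (card U) - 1)\<^sup>2"
        by (intro power_mono) auto
      also have "\<dots> = 8 * real (card (E U)) + 1"
        using eq by (simp add: power2_eq_square algebra_simps)
      finally have "(real N)\<^sup>2 - 1 \<le> 8 * real (card (E U))" by simp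
      then have "x * ((real N)\<^sup>2 - 1) \<le> x * (8 * real (card (E U)))"
        using x by (intro mult_left_mono)
      then show ?thesis by simp
    qed
    finally show "measure_pmf.prob (corruption \<delta> n) (bad U) \<le> exp (- x * (real N ^ 2 - 1) / 8)" .
  qed
  also have "\<dots> = real (card \<U>) * exp (- x * (real N ^ 2 - 1) / 8)" by simp
  also have "\<dots> \<le> exp (real N) * exp (- x * (real N ^ 2 - 1) / 8)"
  proof (rule mult_right_mono)
    \<comment> \<open>The union bound costs at most \<open>2 ^ N\<close> terms, which is the
      \<open>real N\<close> in the exponent.\<close>
    have "real (card \<U>) \<le> 2 ^ N" using fin\<U>(2) by (metis of_nat_le_iff of_nat_numeral of_nat_power)
    also have "\<dots> \<le> exp 1 ^ N" using exp_ge_add_one_self[of 1] by (intro power_mono) auto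
    finally show "real (card \<U>) \<le> exp (real N)" using exp_of_nat_mult[of N "1::real"] by simp
  qed simp
  finally show ?thesis
    by (simp add: x_def flip: exp_add)
qed

section \<open>Hidden splits of clusters\<close>

text \<open>All positions from \<open>N * m\<close> on are put into one extra block
  \<open>N\<close>, which \<open>mate\<close> fixes. So there are at most \<open>N + 1\<close>
  blocks, and the leftover block is never merged.\<close>

definition block :: "nat \<Rightarrow> nat \<Rightarrow> nat \<Rightarrow> nat" where
  "block m N p = min (p div m) N"

text \<open>The smaller of a block and its mate serves as the common name of the two; an unmatched
  block is a cluster by itself.\<close>

definition cluster :: "nat \<Rightarrow> nat \<Rightarrow> (nat \<times> nat \<Rightarrow> bool) \<Rightarrow> nat \<Rightarrow> nat" where
  "cluster m N S p = min (block m N p) (mate m N S (block m N p))"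

text \<open>The offset inside the block is kept, which makes this an involution.\<close>

definition twin :: "nat \<Rightarrow> nat \<Rightarrow> (nat \<times> nat \<Rightarrow> bool) \<Rightarrow> nat \<Rightarrow> nat" where
  "twin m N S p = mate m N S (p div m) * m + p mod m"

text \<open>
  The weak distances will merge each matched block with its mate, so they do not reveal which of
  the two blocks contains a hidden position.
\<close>

definition hidden :: "nat \<Rightarrow> nat \<Rightarrow> (nat \<times> nat \<Rightarrow> bool) \<Rightarrow> nat set" where
  "hidden m N S = {p. p div m \<in> matched N (mate m N S)}"

lemma cluster_eq_iff:
  "cluster m N S p = cluster m N S q \<longleftrightarrow>
     block m N q = block m N p \<or> block m N q = mate m N S (block m N p)"
  unfolding cluster_def
  by (metis mate_mate min.commute min_def)

context
  fixes m N :: nat and S :: "nat \<times> nat \<Rightarrow> bool"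
  assumes m: "0 < m"
begin

lemma hidden_block: "p \<in> hidden m N S \<Longrightarrow> block m N p = p div m"
  by (auto simp: hidden_def matched_def block_def)

lemma hidden_iff_block: "p \<in> hidden m N S \<longleftrightarrow> block m N p \<in> matched N (mate m N S)"
  by (auto simp: hidden_def matched_def block_def min_def not_le)

lemma twin_div: "twin m N S p div m = mate m N S (p div m)"
  using m by (simp add: twin_def)

lemma twin_twin [simp]: "twin m N S (twin m N S p) = p"
  using m by (simp add: twin_def)

lemma twin_hidden: "p \<in> hidden m N S \<Longrightarrow> twin m N S p \<in> hidden m N S"
  using mate_less[of _ N m S] by (auto simp: hidden_def twin_div matched_def)

lemma block_twin: "p \<in> hidden m N S \<Longrightarrow> block m N (twin m N S p) = mate m N S (block m N p)"
  by (simp add: hidden_block twin_hidden twin_div)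

lemma block_twin_neq: "p \<in> hidden m N S \<Longrightarrow> block m N (twin m N S p) \<noteq> block m N p"
  by (simp add: block_twin hidden_iff_block matched_def)

lemma cluster_twin: "p \<in> hidden m N S \<Longrightarrow> cluster m N S (twin m N S p) = cluster m N S p"
  using cluster_eq_iff[of m N S p "twin m N S p"] by (simp add: block_twin)

lemma cluster_eq_hidden:
  assumes "cluster m N S p = cluster m N S q" "p \<in> hidden m N S"
  shows "q \<in> hidden m N S"
  using assms mate_less[of _ N m S] by (auto simp: cluster_eq_iff hidden_iff_block matched_def)

lemma hidden_less: "p \<in> hidden m N S \<Longrightarrow> p < N * m"
  using m by (auto simp: hidden_def matched_def div_less_iff_less_mult)

lemma card_div_mem:
  assumes "finite G"
  shows "finite {p. p div m \<in> G}" "card {p. p div m \<in> G} = m * card G"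
proof -
  have *: "{p. p div m \<in> G} = (\<Union>g\<in>G. {g * m..<Suc g * m})"
    by (auto simp: mem_block_iff[OF m] simp del: atLeastLessThan_iff mult_Suc)
  show "finite {p. p div m \<in> G}" using assms by (simp add: *)
  have "card (\<Union>g\<in>G. {g * m..<Suc g * m}) = (\<Sum>g\<in>G. card {g * m..<Suc g * m})"
    by (intro card_UN_disjoint assms)
       (auto simp: mem_block_iff[OF m] simp del: atLeastLessThan_iff mult_Suc)
  then show "card {p. p div m \<in> G} = m * card G" by (simp add: *)
qed

lemma card_hidden: "card (hidden m N S) = m * card (matched N (mate m N S))"
  and finite_hidden: "finite (hidden m N S)"
  using card_div_mem[of "matched N (mate m N S)"] by (auto simp: hidden_def)

text \<open>A cluster is the union of at most two blocks. This limits how many hidden points one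
  strong query can expose.\<close>

lemma card_hidden_cluster: "card {q\<in>hidden m N S. cluster m N S q = cluster m N S p} \<le> 2 * m"
proof -
  let ?G = "{block m N p, mate m N S (block m N p)}"
  have "{q\<in>hidden m N S. cluster m N S q = cluster m N S p} \<subseteq> {q. q div m \<in> ?G}"
    by (auto simp: cluster_eq_iff[of _ _ _ _ p] hidden_block)
  then have "card {q\<in>hidden m N S. cluster m N S q = cluster m N S p} \<le> card {q. q div m \<in> ?G}"
    using card_div_mem[of ?G] by (intro card_mono) auto
  also have "\<dots> = m * card ?G" using card_div_mem[of ?G] by simp
  also have "\<dots> \<le> m * 2" by (intro mult_left_mono) (auto simp: card_insert_if)
  finally show ?thesis by simp
qed

section \<open>The involution on permutations and its invisibility to the algorithm\<close>

text \<open>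
  Exchanging the position of \<open>y\<close> with its twin changes neither the weak distances nor the symbols
  outside the cluster of \<open>x\<close>, but decides whether \<open>x\<close> and \<open>y\<close> share a block.
\<close>

definition swap_hidden :: "nat \<Rightarrow> nat \<Rightarrow> (nat \<Rightarrow> nat) \<Rightarrow> nat \<Rightarrow> nat" where
  "swap_hidden x y \<sigma> = (if cluster m N S (\<sigma> y) = cluster m N S (\<sigma> x)
     then Transposition.transpose (\<sigma> y) (twin m N S (\<sigma> y)) \<circ> \<sigma> else \<sigma>)"

lemma cluster_transpose:
  "p \<in> hidden m N S \<Longrightarrow> cluster m N S (Transposition.transpose p (twin m N S p) q) = cluster m N S q"
  by (auto simp: Transposition.transpose_def cluster_twin)

lemma cluster_swap_hidden:
  assumes "\<sigma> x \<in> hidden m N S"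
  shows "cluster m N S (swap_hidden x y \<sigma> z) = cluster m N S (\<sigma> z)"
  using assms cluster_eq_hidden[of "\<sigma> x" "\<sigma> y"] by (auto simp: swap_hidden_def cluster_transpose)

text \<open>The clusters do not change, so the second application takes the same branch. There
  \<open>y\<close> sits at the twin of its old position, which yields the same transposition
  again.\<close>

lemma swap_hidden_involution:
  assumes "\<sigma> x \<in> hidden m N S"
  shows "swap_hidden x y (swap_hidden x y \<sigma>) = \<sigma>"
proof (cases "cluster m N S (\<sigma> y) = cluster m N S (\<sigma> x)")
  case True
  then have "cluster m N S (swap_hidden x y \<sigma> y) = cluster m N S (swap_hidden x y \<sigma> x)"
    using cluster_swap_hidden[of \<sigma> x, OF assms] by simp
  then have "swap_hidden x y (swap_hidden x y \<sigma>) =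
      Transposition.transpose (swap_hidden x y \<sigma> y) (twin m N S (swap_hidden x y \<sigma> y)) \<circ> swap_hidden x y \<sigma>"
    by (subst (1) swap_hidden_def) simp
  also have "\<dots> = \<sigma>"
    using True by (simp add: swap_hidden_def transpose_commute fun_eq_iff)
  finally show ?thesis .
qed (simp add: swap_hidden_def)

lemma swap_hidden_permutes:
  assumes "\<sigma> permutes {..<n}" "N * m \<le> n" "\<sigma> x \<in> hidden m N S"
  shows "swap_hidden x y \<sigma> permutes {..<n}"
proof (cases "cluster m N S (\<sigma> y) = cluster m N S (\<sigma> x)")
  case True
  then have "\<sigma> y \<in> hidden m N S" using cluster_eq_hidden[of "\<sigma> x" "\<sigma> y"] assms by simp
  then have "\<sigma> y < n" "twin m N S (\<sigma> y) < n"
    using hidden_less[of "\<sigma> y"] hidden_less[OF twin_hidden, of "\<sigma> y"] assms(2) by auto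
  then show ?thesis
    using True assms by (auto simp: swap_hidden_def intro!: permutes_compose permutes_swap_id)
qed (use assms in \<open>simp add: swap_hidden_def\<close>)

text \<open>If \<open>x\<close> and \<open>y\<close> share a block, the exchange moves
  \<open>y\<close> to the mate of that block. It leaves \<open>x\<close> in place, because the twin
  of the position of \<open>y\<close> lies in another block.\<close>

lemma swap_hidden_separates:
  assumes \<sigma>: "\<sigma> permutes {..<n}" and xy: "x \<noteq> y" and x: "\<sigma> x \<in> hidden m N S"
  shows "block m N (\<sigma> y) \<noteq> block m N (\<sigma> x) \<or>
    block m N (swap_hidden x y \<sigma> y) \<noteq> block m N (swap_hidden x y \<sigma> x)"
proof (rule disjCI, rule notI)
  assume "\<not> block m N (swap_hidden x y \<sigma> y) \<noteq> block m N (swap_hidden x y \<sigma> x)"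
    and eq: "block m N (\<sigma> y) = block m N (\<sigma> x)"
  have "cluster m N S (\<sigma> y) = cluster m N S (\<sigma> x)" using eq by (simp add: cluster_def)
  moreover from this x have y: "\<sigma> y \<in> hidden m N S"
    using cluster_eq_hidden[of "\<sigma> x" "\<sigma> y"] by simp
  moreover have "\<sigma> x \<noteq> \<sigma> y" using permutes_inj[OF \<sigma>] xy by (metis injD)
  moreover have "\<sigma> x \<noteq> twin m N S (\<sigma> y)" using block_twin_neq[OF y] eq by auto
  ultimately have "swap_hidden x y \<sigma> y = twin m N S (\<sigma> y)" "swap_hidden x y \<sigma> x = \<sigma> x"
    by (simp_all add: swap_hidden_def)
  then show False
    using block_twin_neq[OF y] eq \<open>\<not> block m N (swap_hidden x y \<sigma> y) \<noteq> _\<close> by simp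
qed

text \<open>The pattern \<open>S\<close> refers to positions, not points, so it can be fixed while
  \<open>\<sigma>\<close> varies. The weak answers then depend on \<open>\<sigma>\<close> only
  through clusters; \<open>outcome_hard_instance\<close> relates this to the real run.\<close>

definition hidden_trace :: "alg \<Rightarrow> (nat \<Rightarrow> nat) \<Rightarrow> ((nat \<times> nat) set \<times> nat list) pmf" where
  "hidden_trace a \<sigma> = run_trace (two_level (real m) (cluster m N S \<circ> \<sigma>))
     (\<lambda>z. prod_encode (z, block m N (\<sigma> z))) a"

definition unqueried :: "(nat \<Rightarrow> nat) \<Rightarrow> nat \<Rightarrow> nat list \<Rightarrow> bool" where
  "unqueried \<sigma> x l \<longleftrightarrow> set l \<inter> {z. cluster m N S (\<sigma> z) = cluster m N S (\<sigma> x)} = {}"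

lemma hidden_trace_swap_hidden:
  assumes x: "\<sigma> x \<in> hidden m N S"
  shows "(\<integral>\<^sup>+ (T, l). f T * of_bool (unqueried (swap_hidden x y \<sigma>) x l) \<partial>hidden_trace a (swap_hidden x y \<sigma>))
    = (\<integral>\<^sup>+ (T, l). f T * of_bool (unqueried \<sigma> x l) \<partial>hidden_trace a \<sigma>)"
proof -
  let ?\<tau> = "swap_hidden x y \<sigma>"
  let ?C = "{z. cluster m N S (\<sigma> z) = cluster m N S (\<sigma> x)}"
  have cl: "cluster m N S \<circ> ?\<tau> = cluster m N S \<circ> \<sigma>"
    using cluster_swap_hidden[of \<sigma> x, OF x] by auto
  have unq: "unqueried ?\<tau> x l = unqueried \<sigma> x l" for l
    using cluster_swap_hidden[of \<sigma> x, OF x] by (simp add: unqueried_def)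
  have agree: "?\<tau> z = \<sigma> z" if "z \<notin> ?C" for z
  proof (cases "cluster m N S (\<sigma> y) = cluster m N S (\<sigma> x)")
    case True
    then have "\<sigma> y \<in> hidden m N S" using cluster_eq_hidden[of "\<sigma> x" "\<sigma> y"] x by simp
    then have "\<sigma> z \<noteq> \<sigma> y" "\<sigma> z \<noteq> twin m N S (\<sigma> y)" using that True cluster_twin by auto
    then show ?thesis by (simp add: swap_hidden_def)
  qed (simp add: swap_hidden_def)
  show ?thesis
    unfolding hidden_trace_def cl unq
    unfolding unqueried_def
    by (rule run_trace_indistinguishable) (simp add: agree)
qed

text \<open>With \<open>f T\<close> the indicator that \<open>y\<close> is the neighbour of
  \<open>x\<close>, this says: among the runs that leave the cluster of \<open>x\<close> unqueried,
  \<open>y\<close> lies in another block with at least half of the weight. Both points are fixed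
  because the involution depends on them.\<close>

lemma separated_half:
  assumes "N * m \<le> n" "x \<noteq> y"
  defines "P \<equiv> {\<sigma>. \<sigma> permutes {..<n} \<and> \<sigma> x \<in> hidden m N S}"
  shows "(\<Sum>\<sigma>\<in>P. \<integral>\<^sup>+ (T, l). f T * of_bool (unqueried \<sigma> x l) \<partial>hidden_trace a \<sigma>) \<le>
    2 * (\<Sum>\<sigma>\<in>P. (\<integral>\<^sup>+ (T, l). f T * of_bool (unqueried \<sigma> x l) \<partial>hidden_trace a \<sigma>) *
      of_bool (block m N (\<sigma> y) \<noteq> block m N (\<sigma> x)))"
proof (rule sum_involution_le[where \<iota> = "swap_hidden x y"])
  show "finite P" using finite_permutations[of "{..<n}"] by (rule rev_finite_subset) (auto simp: P_def)
  show "swap_hidden x y \<sigma> \<in> P" if "\<sigma> \<in> P" for \<sigma>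
    using that assms(1) swap_hidden_permutes cluster_eq_hidden[of "\<sigma> x" "swap_hidden x y \<sigma> x"]
    by (auto simp: P_def cluster_swap_hidden)
qed (use assms(2) swap_hidden_separates in \<open>auto simp: P_def swap_hidden_involution hidden_trace_swap_hidden\<close>)

text \<open>A hidden point either has its cluster queried, which each query causes for at most
  \<open>2 * m\<close> points, or is crossing in at least half of the cases. The coefficient
  \<open>4 / m\<close> combines this half with the bound of
  \<open>crossing_le_weight\<close>.\<close>

lemma average_cost_ge:
  fixes a :: alg
  assumes n: "2 \<le> n" and Nm: "N * m \<le> n"
    and tree: "\<And>\<sigma> T l. \<sigma> permutes {..<n} \<Longrightarrow> (T, l) \<in> set_pmf (hidden_trace a \<sigma>) \<Longrightarrow> spanning_tree n T"
  defines "P \<equiv> {\<sigma>. \<sigma> permutes {..<n}}"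
  shows "of_nat (card P * card (hidden m N S)) \<le> (\<Sum>\<sigma>\<in>P. \<integral>\<^sup>+ (T, l).
      ennreal (4 / real m * weight (two_level (real m) (block m N \<circ> \<sigma>)) T + 2 * real m * real (length l))
      \<partial>hidden_trace a \<sigma>)"
proof -
  define X where "X \<sigma> = {x\<in>{..<n}. \<sigma> x \<in> hidden m N S}" for \<sigma>
  define Y where "Y x = {..<n} - {x}" for x
  \<comment> \<open>Splitting by the value \<open>y\<close> of the neighbour turns the
    output-dependent pair into fixed pairs, as \<open>separated_half\<close> requires.\<close>
  define h :: "(nat \<Rightarrow> nat) \<Rightarrow> nat \<Rightarrow> nat \<Rightarrow> (nat \<times> nat) set \<times> nat list \<Rightarrow> ennreal" where
    "h \<sigma> x y = (\<lambda>(T, l). of_bool (neighbour T x = y) * of_bool (unqueried \<sigma> x l))" for \<sigma> x y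
  define sep :: "(nat \<Rightarrow> nat) \<Rightarrow> nat \<Rightarrow> nat \<Rightarrow> bool" where
    "sep \<sigma> x y \<longleftrightarrow> block m N (\<sigma> y) \<noteq> block m N (\<sigma> x)" for \<sigma> x y
  have finP: "finite P" unfolding P_def by (rule finite_permutations) simp
  have finX: "finite (X \<sigma>)" for \<sigma> by (simp add: X_def)
  \<comment> \<open>The hidden positions all lie below \<open>n\<close>, so every permutation fills
    them with equally many points.\<close>
  have cardX: "card (X \<sigma>) = card (hidden m N S)" if "\<sigma> \<in> P" for \<sigma>
  proof (rule bij_betw_same_card[of \<sigma>])
    have \<sigma>: "\<sigma> permutes {..<n}" using that by (simp add: P_def)
    have "q \<in> \<sigma> ` X \<sigma>" if "q \<in> hidden m N S" for q
    proof
      have "q < n" using hidden_less[OF that] Nm by simp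
      then show "inv \<sigma> q \<in> X \<sigma>" "q = \<sigma> (inv \<sigma> q)"
        using that permutes_inverses[OF \<sigma>] permutes_in_image[OF permutes_inv[OF \<sigma>], of q]
        by (auto simp: X_def)
    qed
    then show "bij_betw \<sigma> (X \<sigma>) (hidden m N S)"
      using permutes_inj[OF \<sigma>] by (auto simp: bij_betw_def X_def intro: inj_on_subset)
  qed
  have queried: "card {x\<in>X \<sigma>. \<not> unqueried \<sigma> x l} \<le> 2 * m * length l" if "\<sigma> \<in> P" for \<sigma> l
  proof -
    have \<sigma>: "inj \<sigma>" using that permutes_inj by (auto simp: P_def)
    let ?Z = "\<lambda>z. {x\<in>X \<sigma>. cluster m N S (\<sigma> x) = cluster m N S (\<sigma> z)}"
    have "{x\<in>X \<sigma>. \<not> unqueried \<sigma> x l} \<subseteq> (\<Union>z\<in>set l. ?Z z)"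
      by (auto simp: unqueried_def)
    then have "card {x\<in>X \<sigma>. \<not> unqueried \<sigma> x l} \<le> card (\<Union>z\<in>set l. ?Z z)"
      using finX by (intro card_mono) auto
    also have "\<dots> \<le> (\<Sum>z\<in>set l. card (?Z z))" by (rule card_UN_le) simp
    also have "\<dots> \<le> (\<Sum>z\<in>set l. 2 * m)"
    proof (rule sum_mono)
      fix z
      have "card (?Z z) \<le> card {q\<in>hidden m N S. cluster m N S q = cluster m N S (\<sigma> z)}"
        using finite_hidden \<sigma> by (intro card_inj_on_le[of \<sigma>]) (auto simp: X_def intro: inj_on_subset)
      then show "card (?Z z) \<le> 2 * m" using card_hidden_cluster[of "\<sigma> z"] by linarith
    qed
    also have "\<dots> \<le> 2 * m * length l" using card_length[of l] by simp
    finally show ?thesis .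
  qed
  have split: "of_nat (card (hidden m N S)) \<le>
      (\<Sum>x\<in>X \<sigma>. \<Sum>y\<in>Y x. h \<sigma> x y (T, l)) + ennreal (2 * real m * real (length l))"
    if "\<sigma> \<in> P" "(T, l) \<in> set_pmf (hidden_trace a \<sigma>)" for \<sigma> T l
  proof -
    have T: "spanning_tree n T" using tree that by (auto simp: P_def)
    have "(\<Sum>y\<in>Y x. h \<sigma> x y (T, l)) = of_bool (unqueried \<sigma> x l)" if "x \<in> X \<sigma>" for x
    proof -
      have "neighbour T x \<in> Y x" using neighbour_bounds[OF T _ n, of x] that by (auto simp: X_def Y_def)
      then have "(\<Sum>y\<in>Y x. h \<sigma> x y (T, l)) = (\<Sum>y\<in>{neighbour T x}. h \<sigma> x y (T, l))"
        by (intro sum.mono_neutral_right) (auto simp: Y_def h_def)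
      then show ?thesis by (simp add: h_def)
    qed
    then have "(\<Sum>x\<in>X \<sigma>. \<Sum>y\<in>Y x. h \<sigma> x y (T, l)) = (\<Sum>x\<in>X \<sigma>. of_bool (unqueried \<sigma> x l))" by simp
    also have "\<dots> = of_nat (card {x\<in>X \<sigma>. unqueried \<sigma> x l})"
      using finX by (simp add: of_bool_def sum.If_cases Int_def)
    finally have eq: "(\<Sum>x\<in>X \<sigma>. \<Sum>y\<in>Y x. h \<sigma> x y (T, l)) = of_nat (card {x\<in>X \<sigma>. unqueried \<sigma> x l})" .
    have "X \<sigma> = {x\<in>X \<sigma>. unqueried \<sigma> x l} \<union> {x\<in>X \<sigma>. \<not> unqueried \<sigma> x l}" by blast
    then have "card (X \<sigma>) \<le> card {x\<in>X \<sigma>. unqueried \<sigma> x l} + card {x\<in>X \<sigma>. \<not> unqueried \<sigma> x l}"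
      by (metis card_Un_le)
    also have "\<dots> \<le> card {x\<in>X \<sigma>. unqueried \<sigma> x l} + 2 * m * length l"
      using queried[OF that(1)] by simp
    finally have "(of_nat (card (hidden m N S)) :: ennreal) \<le>
        of_nat (card {x\<in>X \<sigma>. unqueried \<sigma> x l} + 2 * m * length l)"
      using cardX[OF that(1)] by (simp only: of_nat_mono)
    also have "\<dots> = of_nat (card {x\<in>X \<sigma>. unqueried \<sigma> x l}) + ennreal (2 * real m * real (length l))"
      by (simp add: ennreal_of_nat_eq_real_of_nat flip: ennreal_plus)
    finally show ?thesis by (simp add: eq)
  qed
  have cross: "2 * (\<Sum>x\<in>X \<sigma>. \<Sum>y\<in>Y x. h \<sigma> x y (T, l) * of_bool (sep \<sigma> x y)) \<le>
      ennreal (4 / real m * weight (two_level (real m) (block m N \<circ> \<sigma>)) T)"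
    if "\<sigma> \<in> P" "(T, l) \<in> set_pmf (hidden_trace a \<sigma>)" for \<sigma> T l
  proof -
    have T: "spanning_tree n T" using tree that by (auto simp: P_def)
    let ?K = "crossing (block m N \<circ> \<sigma>) n T"
    have "(\<Sum>y\<in>Y x. h \<sigma> x y (T, l) * of_bool (sep \<sigma> x y)) \<le> of_bool (x \<in> ?K)" if "x \<in> X \<sigma>" for x
    proof -
      have "neighbour T x \<in> Y x" using neighbour_bounds[OF T _ n, of x] that by (auto simp: X_def Y_def)
      then have "(\<Sum>y\<in>Y x. h \<sigma> x y (T, l) * of_bool (sep \<sigma> x y)) =
          (\<Sum>y\<in>{neighbour T x}. h \<sigma> x y (T, l) * of_bool (sep \<sigma> x y))"
        by (intro sum.mono_neutral_right) (auto simp: Y_def h_def)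
      also have "\<dots> \<le> of_bool (x \<in> ?K)"
        using that by (auto simp: h_def sep_def crossing_def X_def)
      finally show ?thesis .
    qed
    then have "(\<Sum>x\<in>X \<sigma>. \<Sum>y\<in>Y x. h \<sigma> x y (T, l) * of_bool (sep \<sigma> x y)) \<le> (\<Sum>x\<in>X \<sigma>. of_bool (x \<in> ?K))"
      by (rule sum_mono)
    also have "\<dots> \<le> (\<Sum>x\<in>{..<n}. of_bool (x \<in> ?K))"
      by (rule sum_mono2) (auto simp: X_def)
    also have "\<dots> = of_nat (card ({..<n} \<inter> ?K))"
      by (simp add: of_bool_def sum.If_cases)
    also have "{..<n} \<inter> ?K = ?K" by (auto simp: crossing_def)
    finally have "2 * (\<Sum>x\<in>X \<sigma>. \<Sum>y\<in>Y x. h \<sigma> x y (T, l) * of_bool (sep \<sigma> x y)) \<le>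
        2 * (of_nat (card ?K) :: ennreal)" by (rule mult_left_mono) simp
    also have "\<dots> = ennreal (2 * real (card ?K))"
      by (simp add: ennreal_of_nat_eq_real_of_nat ennreal_mult)
    also have "\<dots> \<le> ennreal (4 / real m * weight (two_level (real m) (block m N \<circ> \<sigma>)) T)"
      using crossing_le_weight[OF T n, of "real m" "block m N \<circ> \<sigma>"] m
      by (intro ennreal_leI) (simp add: field_simps)
    finally show ?thesis .
  qed
  \<comment> \<open>The sum over permutations is moved inside, since the involution acts on
    permutations for fixed \<open>x\<close> and \<open>y\<close>.\<close>
  have swap: "(\<Sum>\<sigma>\<in>P. \<Sum>x\<in>X \<sigma>. \<Sum>y\<in>Y x. F \<sigma> x y) =
      (\<Sum>x<n. \<Sum>y\<in>Y x. \<Sum>\<sigma>\<in>{\<sigma>. \<sigma> permutes {..<n} \<and> \<sigma> x \<in> hidden m N S}. F \<sigma> x y)"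
    for F :: "(nat \<Rightarrow> nat) \<Rightarrow> nat \<Rightarrow> nat \<Rightarrow> ennreal"
  proof -
    have "(\<Sum>\<sigma>\<in>P. \<Sum>x\<in>X \<sigma>. \<Sum>y\<in>Y x. F \<sigma> x y) = (\<Sum>x<n. \<Sum>\<sigma>\<in>{\<sigma>\<in>P. \<sigma> x \<in> hidden m N S}. \<Sum>y\<in>Y x. F \<sigma> x y)"
      unfolding X_def using finP by (rule sum.swap_restrict) simp
    also have "\<dots> = (\<Sum>x<n. \<Sum>y\<in>Y x. \<Sum>\<sigma>\<in>{\<sigma>\<in>P. \<sigma> x \<in> hidden m N S}. F \<sigma> x y)"
      by (intro sum.cong refl sum.swap)
    finally show ?thesis by (simp add: P_def)
  qed
  let ?R = "\<lambda>\<sigma>. measure_pmf (hidden_trace a \<sigma>)"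
  have "(\<Sum>\<sigma>\<in>P. \<integral>\<^sup>+ w. (\<Sum>x\<in>X \<sigma>. \<Sum>y\<in>Y x. h \<sigma> x y w) \<partial>?R \<sigma>) =
      (\<Sum>\<sigma>\<in>P. \<Sum>x\<in>X \<sigma>. \<Sum>y\<in>Y x. \<integral>\<^sup>+ w. h \<sigma> x y w \<partial>?R \<sigma>)"
    by (simp add: nn_integral_sum)
  also have "\<dots> \<le> (\<Sum>x<n. \<Sum>y\<in>Y x. 2 * (\<Sum>\<sigma>\<in>{\<sigma>. \<sigma> permutes {..<n} \<and> \<sigma> x \<in> hidden m N S}.
      (\<integral>\<^sup>+ w. h \<sigma> x y w \<partial>?R \<sigma>) * of_bool (sep \<sigma> x y)))"
    unfolding swap
    by (intro sum_mono) (auto simp: h_def sep_def Y_def intro!: separated_half Nm)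
  also have "\<dots> = 2 * (\<Sum>\<sigma>\<in>P. \<Sum>x\<in>X \<sigma>. \<Sum>y\<in>Y x. (\<integral>\<^sup>+ w. h \<sigma> x y w \<partial>?R \<sigma>) * of_bool (sep \<sigma> x y))"
    unfolding swap by (simp add: sum_distrib_left)
  also have "\<dots> = (\<Sum>\<sigma>\<in>P. \<integral>\<^sup>+ w. 2 * (\<Sum>x\<in>X \<sigma>. \<Sum>y\<in>Y x. h \<sigma> x y w * of_bool (sep \<sigma> x y)) \<partial>?R \<sigma>)"
    by (simp add: nn_integral_sum nn_integral_cmult nn_integral_multc sum_distrib_left)
  finally have half: "(\<Sum>\<sigma>\<in>P. \<integral>\<^sup>+ w. (\<Sum>x\<in>X \<sigma>. \<Sum>y\<in>Y x. h \<sigma> x y w) \<partial>?R \<sigma>) \<le>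
      (\<Sum>\<sigma>\<in>P. \<integral>\<^sup>+ w. 2 * (\<Sum>x\<in>X \<sigma>. \<Sum>y\<in>Y x. h \<sigma> x y w * of_bool (sep \<sigma> x y)) \<partial>?R \<sigma>)" .
  let ?q = "\<lambda>w. ennreal (2 * real m * real (length (snd w)))"
  have "of_nat (card P * card (hidden m N S)) = (\<Sum>\<sigma>\<in>P. \<integral>\<^sup>+ w. of_nat (card (hidden m N S)) \<partial>?R \<sigma>)"
    by simp
  also have "\<dots> \<le> (\<Sum>\<sigma>\<in>P. \<integral>\<^sup>+ w. (\<Sum>x\<in>X \<sigma>. \<Sum>y\<in>Y x. h \<sigma> x y w) + ?q w \<partial>?R \<sigma>)"
    using split by (intro sum_mono nn_integral_mono_AE) (auto intro!: AE_pmfI)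
  also have "\<dots> = (\<Sum>\<sigma>\<in>P. \<integral>\<^sup>+ w. (\<Sum>x\<in>X \<sigma>. \<Sum>y\<in>Y x. h \<sigma> x y w) \<partial>?R \<sigma>) + (\<Sum>\<sigma>\<in>P. \<integral>\<^sup>+ w. ?q w \<partial>?R \<sigma>)"
    by (simp add: nn_integral_add sum.distrib)
  also have "\<dots> \<le> (\<Sum>\<sigma>\<in>P. \<integral>\<^sup>+ w. 2 * (\<Sum>x\<in>X \<sigma>. \<Sum>y\<in>Y x. h \<sigma> x y w * of_bool (sep \<sigma> x y)) \<partial>?R \<sigma>)
      + (\<Sum>\<sigma>\<in>P. \<integral>\<^sup>+ w. ?q w \<partial>?R \<sigma>)"
    by (rule add_right_mono[OF half])
  also have "\<dots> = (\<Sum>\<sigma>\<in>P. \<integral>\<^sup>+ w. 2 * (\<Sum>x\<in>X \<sigma>. \<Sum>y\<in>Y x. h \<sigma> x y w * of_bool (sep \<sigma> x y)) + ?q w \<partial>?R \<sigma>)"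
    by (simp add: nn_integral_add sum.distrib)
  also have "\<dots> \<le> (\<Sum>\<sigma>\<in>P. \<integral>\<^sup>+ w. (case w of (T, l) \<Rightarrow>
      ennreal (4 / real m * weight (two_level (real m) (block m N \<circ> \<sigma>)) T + 2 * real m * real (length l))) \<partial>?R \<sigma>)"
  proof (intro sum_mono nn_integral_mono_AE AE_pmfI)
    fix \<sigma> w assume \<sigma>: "\<sigma> \<in> P" and "w \<in> set_pmf (hidden_trace a \<sigma>)"
    then obtain T l where w: "w = (T, l)" "(T, l) \<in> set_pmf (hidden_trace a \<sigma>)" by (cases w) auto
    have "0 \<le> weight (two_level (real m) (block m N \<circ> \<sigma>)) T"
      unfolding weight_def by (intro sum_nonneg) (auto simp: two_level_def)
    then show "2 * (\<Sum>x\<in>X \<sigma>. \<Sum>y\<in>Y x. h \<sigma> x y w * of_bool (sep \<sigma> x y)) + ?q w \<le> (case w of (T, l) \<Rightarrow>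
      ennreal (4 / real m * weight (two_level (real m) (block m N \<circ> \<sigma>)) T + 2 * real m * real (length l)))"
      using cross[OF \<sigma> w(2)] by (simp add: w(1) ennreal_plus add_right_mono)
  qed
  finally show ?thesis .
qed

end

section \<open>The hard instances\<close>

text \<open>The symbol carries the name of the point to tell distance \<open>0\<close> from distance
  \<open>1\<close> inside a block. The function does not involve the permutation, so knowing it
  reveals nothing about the blocks.\<close>

definition hard_decode :: "nat \<Rightarrow> nat \<Rightarrow> nat \<Rightarrow> real" where
  "hard_decode m a b = (let (x, g) = prod_decode a; (y, h) = prod_decode b in
     if x = y then 0 else if g = h then 1 else real m)"

text \<open>
  The permutation \<open>\<sigma>\<close> sends a point to its position, and the adversary reads the corruption
  pattern in terms of positions.
\<close>

definition hard_instance :: "nat \<Rightarrow> nat \<Rightarrow> nat \<Rightarrow> (nat \<Rightarrow> nat) \<Rightarrow> ws_instance" where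
  "hard_instance m N n \<sigma> =
     \<lparr>metric = two_level (real m) (block m N \<circ> \<sigma>),
      symbol = (\<lambda>z. prod_encode (z, block m N (\<sigma> z))),
      decode = hard_decode m,
      adversary = (\<lambda>S (x, y). two_level (real m) (cluster m N (S \<circ> relabel n (inv \<sigma>)) \<circ> \<sigma>) x y)\<rparr>"

text \<open>Different blocks in one cluster are mates. On exactly such pairs of positions the shown
  distance may differ from the true one, so these pairs must be corrupted.\<close>

lemma same_cluster_corrupted:
  assumes m: "0 < m" and pq: "p < q" "cluster m N S p = cluster m N S q" "block m N p \<noteq> block m N q"
  shows "q < N * m" "S (p, q)"
proof -
  have eq: "block m N q = mate m N S (block m N p)" using pq by (auto simp: cluster_eq_iff)
  have "block m N p < N"
  proof (rule ccontr)
    assume "\<not> block m N p < N"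
    then show False using eq pq(3) by simp
  qed
  moreover from this have "block m N q < N" using eq mate_less by simp
  ultimately have *: "block m N p = p div m" "block m N q = q div m" "q div m < N"
    by (auto simp: block_def min_def split: if_splits)
  then show "q < N * m" using m by (simp add: div_less_iff_less_mult)
  then show "S (p, q)" using mate_corrupted[of p q N m S] pq * eq by simp
qed

text \<open>\<open>S \<circ> relabel n \<sigma>\<close> is the pattern on points that reads as
  \<open>S\<close> on positions. On uncorrupted pairs truth and display agree, because there sharing
  a cluster means sharing a block.\<close>

lemma weak_dist_hard_instance:
  assumes m: "0 < m" and Nm: "N * m \<le> n" and \<sigma>: "\<sigma> permutes {..<n}"
  shows "weak_dist (hard_instance m N n \<sigma>) (S \<circ> relabel n \<sigma>) = two_level (real m) (cluster m N S \<circ> \<sigma>)"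
proof (intro ext)
  fix x y
  let ?I = "hard_instance m N n \<sigma>"
  have "relabel n \<sigma> (relabel n (inv \<sigma>) e) = e" for e
    using relabel_relabel[OF permutes_inv[OF \<sigma>], of \<sigma>] permutes_inverses[OF \<sigma>] by simp
  then have "S \<circ> relabel n \<sigma> \<circ> relabel n (inv \<sigma>) = S" by auto
  then have adv: "adversary ?I (S \<circ> relabel n \<sigma>) (x', y') = two_level (real m) (cluster m N S \<circ> \<sigma>) x' y'" for x' y'
    by (simp add: hard_instance_def)
  have sym: "two_level (real m) (cluster m N S \<circ> \<sigma>) (min x y) (max x y) =
      two_level (real m) (cluster m N S \<circ> \<sigma>) x y"
    by (auto simp: min_def max_def two_level_commute)
  show "weak_dist ?I (S \<circ> relabel n \<sigma>) x y = two_level (real m) (cluster m N S \<circ> \<sigma>) x y"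
  proof (cases "(S \<circ> relabel n \<sigma>) (min x y, max x y)")
    case True
    then show ?thesis by (simp add: weak_dist_def adv sym)
  next
    case False
    have "block m N (\<sigma> x) = block m N (\<sigma> y)"
      if "x \<noteq> y" and cl: "cluster m N S (\<sigma> x) = cluster m N S (\<sigma> y)"
    proof (rule ccontr)
      assume ne: "block m N (\<sigma> x) \<noteq> block m N (\<sigma> y)"
      let ?p = "min (\<sigma> x) (\<sigma> y)" and ?q = "max (\<sigma> x) (\<sigma> y)"
      have "\<sigma> x \<noteq> \<sigma> y" using ne by auto
      then have pq: "?p < ?q" "cluster m N S ?p = cluster m N S ?q" "block m N ?p \<noteq> block m N ?q"
        using ne cl by (auto simp: min_def max_def)
      then have "?q < n" "S (?p, ?q)" using same_cluster_corrupted[OF m pq] Nm by auto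
      then have "\<sigma> x < n" "\<sigma> y < n" by auto
      then have "x < n" "y < n" using permutes_in_image[OF \<sigma>] by auto
      then have "(min x y, max x y) \<in> upairs n" using that(1) by (auto simp: upairs_def)
      then have "relabel n \<sigma> (min x y, max x y) = (?p, ?q)"
        by (auto simp: relabel_def min_def max_def)
      then show False using False \<open>S (?p, ?q)\<close> by simp
    qed
    then have "block m N (\<sigma> x) = block m N (\<sigma> y) \<longleftrightarrow> cluster m N S (\<sigma> x) = cluster m N S (\<sigma> y)" if "x \<noteq> y"
      using that by (auto simp: cluster_def)
    then show ?thesis using False
      by (auto simp: weak_dist_def hard_instance_def two_level_def)
  qed
qed

lemma hard_instance_metric_weak:
  assumes m: "0 < m" and Nm: "N * m \<le> n" and \<sigma>: "\<sigma> permutes {..<n}"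
  shows "hard_instance m N n \<sigma> \<in> metric_weak_instances \<delta> n"
proof -
  have "Metric_space {..<n} (weak_dist (hard_instance m N n \<sigma>) S)" for S
  proof -
    have "relabel n (inv \<sigma>) (relabel n \<sigma> e) = e" for e
      using relabel_relabel[OF \<sigma>, of "inv \<sigma>"] permutes_inverses[OF \<sigma>] by simp
    then have "S = S \<circ> relabel n (inv \<sigma>) \<circ> relabel n \<sigma>" by auto
    then show ?thesis
      using weak_dist_hard_instance[OF assms, of "S \<circ> relabel n (inv \<sigma>)"] m
      by (simp add: Metric_space_two_level)
  qed
  moreover have "hard_instance m N n \<sigma> \<in> instances n"
    using m by (auto simp: instances_def hard_instance_def Metric_space_two_level hard_decode_def two_level_def)
  ultimately show ?thesis by (simp add: metric_weak_instances_def)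
qed

text \<open>By \<open>corruption_relabel\<close> the pattern can be drawn directly on positions,
  with a law that does not depend on \<open>\<sigma>\<close>.\<close>

lemma outcome_hard_instance:
  assumes "0 < m" "N * m \<le> n" "\<sigma> permutes {..<n}"
  shows "outcome \<delta> n A (hard_instance m N n \<sigma>) = bind_pmf (corruption \<delta> n)
    (\<lambda>S. map_pmf (\<lambda>(T, l). (T, length l)) (hidden_trace m N S (A (hard_decode m)) \<sigma>))"
proof -
  have "symbol (hard_instance m N n \<sigma>) = (\<lambda>z. prod_encode (z, block m N (\<sigma> z)))"
    and "decode (hard_instance m N n \<sigma>) = hard_decode m"
    by (simp_all add: hard_instance_def)
  then show ?thesis
    unfolding outcome_def
    by (subst corruption_relabel[OF assms(3)])
       (simp add: bind_map_pmf weak_dist_hard_instance[OF assms] run_conv_run_trace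
          hidden_trace_def[OF assms(1)])
qed

section \<open>Averaging over the hard instances\<close>

lemma exists_ge_average_ennreal:
  fixes f :: "'a \<Rightarrow> ennreal"
  assumes P: "finite P" "P \<noteq> {}" and le: "of_nat (card P) * c \<le> (\<Sum>s\<in>P. f s)"
  shows "\<exists>s\<in>P. c \<le> f s"
proof -
  have "Max (f ` P) \<in> f ` P" using P by (intro Max_in) auto
  then obtain s where s: "s \<in> P" "f s = Max (f ` P)" by auto
  have "of_nat (card P) * c \<le> (\<Sum>t\<in>P. f s)"
    by (rule order_trans[OF le sum_mono]) (use P s in simp)
  then have "of_nat (card P) * c \<le> of_nat (card P) * f s" by simp
  moreover have "(of_nat (card P) :: ennreal) \<noteq> 0" using P by simp
  ultimately have "c \<le> f s" by (subst (asm) ennreal_mult_le_mult_iff) auto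
  then show ?thesis using s by blast
qed

text \<open>For each pattern the cost is averaged over \<open>\<sigma>\<close>. With probability at
  least \<open>1 / 2\<close> at least \<open>N * m / 2\<close> positions are hidden, so the average
  is at least \<open>N * m / 4\<close>, and some permutation attains it.\<close>

lemma exists_hard_instance:
  assumes m: "0 < m" and Nm: "N * m \<le> n" and n: "2 \<le> n" and \<alpha>: "0 \<le> \<alpha>"
    and good: "1 / 2 \<le> measure_pmf.prob (corruption \<delta> n) {S. N \<le> 2 * card (matched N (mate m N S))}"
    and approx: "\<And>I. I \<in> metric_weak_instances \<delta> n \<Longrightarrow> approximates_mst \<delta> n \<alpha> A I"
  shows "\<exists>I\<in>metric_weak_instances \<delta> n. ennreal (real (N * m) / 4) \<le>
    ennreal (4 / real m * (\<alpha> * (real n + real m * real (N + 1)))) +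
    ennreal (2 * real m) * expected_strong_queries \<delta> n A I"
proof -
  define P where "P = {\<sigma>. \<sigma> permutes {..<n}}"
  define a where "a = A (hard_decode m)"
  define G where "G = {S. N \<le> 2 * card (matched N (mate m N S))}"
  let ?C = "measure_pmf (corruption \<delta> n)"
  let ?I = "hard_instance m N n"
  let ?w = "\<lambda>\<sigma>. weight (two_level (real m) (block m N \<circ> \<sigma>))"
  let ?bound = "\<lambda>\<sigma>. ennreal (4 / real m * (\<alpha> * (real n + real m * real (N + 1)))) +
    ennreal (2 * real m) * expected_strong_queries \<delta> n A (?I \<sigma>)"
  have finP: "finite P" unfolding P_def by (rule finite_permutations) simp
  have "id \<in> P" by (simp add: P_def permutes_id)
  then have P_ne: "P \<noteq> {}" by blast
  have out: "outcome \<delta> n A (?I \<sigma>) = bind_pmf (corruption \<delta> n)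
      (\<lambda>S. map_pmf (\<lambda>(T, l). (T, length l)) (hidden_trace m N S a \<sigma>))" if "\<sigma> \<in> P" for \<sigma>
    using outcome_hard_instance[OF m Nm, of \<sigma> \<delta> A] that by (simp add: P_def a_def)
  have metric: "metric (?I \<sigma>) = two_level (real m) (block m N \<circ> \<sigma>)" for \<sigma>
    by (simp add: hard_instance_def)
  have app: "approximates_mst \<delta> n \<alpha> A (?I \<sigma>)" if "\<sigma> \<in> P" for \<sigma>
    using approx hard_instance_metric_weak[OF m Nm] that by (simp add: P_def)
  have tree: "spanning_tree n T" if "\<sigma> \<in> P" "(T, q) \<in> set_pmf (outcome \<delta> n A (?I \<sigma>))" for \<sigma> T q
    using app[OF that(1)] that(2) by (auto simp: approximates_mst_def)
  have cost: "(\<integral>\<^sup>+ (T, q). ennreal (4 / real m * ?w \<sigma> T + 2 * real m * real q) \<partial>outcome \<delta> n A (?I \<sigma>))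
      \<le> ?bound \<sigma>" if \<sigma>: "\<sigma> \<in> P" for \<sigma>
  proof -
    let ?O = "measure_pmf (outcome \<delta> n A (?I \<sigma>))"
    have w0: "0 \<le> ?w \<sigma> T" for T
      unfolding weight_def by (intro sum_nonneg) (auto simp: two_level_def)
    have "finite (?w \<sigma> ` {T. spanning_tree n T})" by simp
    then have fin: "\<bar>?w \<sigma> T\<bar> \<le> Max (?w \<sigma> ` {T. spanning_tree n T})" if "spanning_tree n T" for T
      using that w0[of T] by (auto intro: Max_ge)
    \<comment> \<open>The expectation in \<open>approximates_mst\<close> would be \<open>0\<close>
      for a non-integrable weight. Only finitely many trees occur, so the weight is bounded and the
      hypothesis transfers to the nonnegative integral.\<close>
    have int: "integrable ?O (\<lambda>(T, q). ?w \<sigma> T)"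
      by (rule measure_pmf.integrable_const_bound[where B = "Max (?w \<sigma> ` {T. spanning_tree n T})"])
         (use tree[OF \<sigma>] fin in \<open>auto intro!: AE_pmfI\<close>)
    have "(\<integral>\<^sup>+ (T, q). ennreal (?w \<sigma> T) \<partial>?O) = ennreal (\<integral> (T, q). ?w \<sigma> T \<partial>?O)"
      using nn_integral_eq_integral[OF int] w0 by (simp add: split_def)
    also have "\<dots> \<le> ennreal (\<alpha> * (real n + real m * real (N + 1)))"
    proof (rule ennreal_leI)
      have "(\<integral> (T, q). ?w \<sigma> T \<partial>?O) \<le> \<alpha> * mst_weight n (two_level (real m) (block m N \<circ> \<sigma>))"
        using app[OF \<sigma>] by (simp add: approximates_mst_def metric)
      also have "\<dots> \<le> \<alpha> * (real n + real m * real (N + 1))"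
        using m \<alpha> by (intro mult_left_mono mst_weight_two_level_le) (auto simp: block_def)
      finally show "(\<integral> (T, q). ?w \<sigma> T \<partial>?O) \<le> \<alpha> * (real n + real m * real (N + 1))" .
    qed
    finally have w: "(\<integral>\<^sup>+ (T, q). ennreal (?w \<sigma> T) \<partial>?O) \<le> ennreal (\<alpha> * (real n + real m * real (N + 1)))" .
    have "ennreal (4 / real m * ?w \<sigma> T + 2 * real m * real q) =
        ennreal (4 / real m) * ennreal (?w \<sigma> T) + ennreal (2 * real m) * ennreal (real q)" for T q
      using w0[of T] by (subst ennreal_plus) (simp_all only: ennreal_mult' ennreal_mult'', simp_all)
    then have "(\<integral>\<^sup>+ (T, q). ennreal (4 / real m * ?w \<sigma> T + 2 * real m * real q) \<partial>?O) =
        (\<integral>\<^sup>+ x. ennreal (4 / real m) * (case x of (T, q) \<Rightarrow> ennreal (?w \<sigma> T)) +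
          ennreal (2 * real m) * (case x of (T, q) \<Rightarrow> ennreal (real q)) \<partial>?O)"
      by (intro nn_integral_cong) (simp split: prod.split)
    also have "\<dots> = ennreal (4 / real m) * (\<integral>\<^sup>+ (T, q). ennreal (?w \<sigma> T) \<partial>?O) +
        ennreal (2 * real m) * expected_strong_queries \<delta> n A (?I \<sigma>)"
      by (simp add: nn_integral_add nn_integral_cmult expected_strong_queries_def)
    also have "\<dots> \<le> ennreal (4 / real m) * ennreal (\<alpha> * (real n + real m * real (N + 1))) +
        ennreal (2 * real m) * expected_strong_queries \<delta> n A (?I \<sigma>)"
      by (intro add_right_mono mult_left_mono w) simp
    also have "\<dots> = ?bound \<sigma>"
    proof -
      have "ennreal (4 / real m * (\<alpha> * (real n + real m * real (N + 1)))) =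
          ennreal (4 / real m) * ennreal (\<alpha> * (real n + real m * real (N + 1)))"
        using \<alpha> by (intro ennreal_mult) auto
      then show ?thesis by (simp only:)
    qed
    finally show ?thesis .
  qed
  have "of_nat (card P) * ennreal (real (N * m) / 4) \<le>
      ennreal (real (card P) * (real (N * m) / 2)) * emeasure ?C G"
  proof -
    have "real (card P) * (real (N * m) / 4) \<le> real (card P) * (real (N * m) / 2) * measure ?C G"
      using mult_left_mono[OF good, of "real (card P) * (real (N * m) / 2)"] by (simp add: G_def)
    then show ?thesis
      by (simp add: ennreal_of_nat_eq_real_of_nat measure_pmf.emeasure_eq_measure ennreal_leI flip: ennreal_mult)
  qed
  also have "\<dots> = (\<integral>\<^sup>+ S. ennreal (real (card P) * (real (N * m) / 2)) * indicator G S \<partial>?C)"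
    by (simp add: nn_integral_cmult_indicator)
  also have "\<dots> \<le> (\<integral>\<^sup>+ S. of_nat (card P * card (hidden m N S)) \<partial>?C)"
  proof (rule nn_integral_mono)
    fix S
    have "real (card P) * (real (N * m) / 2) \<le> real (card P) * real (card (hidden m N S))" if "S \<in> G"
    proof (rule mult_left_mono)
      have "real N \<le> 2 * real (card (matched N (mate m N S)))" using that by (auto simp: G_def)
      then have "real m * real N \<le> real m * (2 * real (card (matched N (mate m N S))))"
        by (rule mult_left_mono) simp
      then show "real (N * m) / 2 \<le> real (card (hidden m N S))"
        by (simp add: card_hidden[OF m] mult.commute)
    qed simp
    then show "ennreal (real (card P) * (real (N * m) / 2)) * indicator G S \<le> of_nat (card P * card (hidden m N S))"
      by (auto simp: ennreal_of_nat_eq_real_of_nat indicator_def ennreal_leI simp del: of_nat_mult)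
         (simp add: ennreal_leI)
  qed
  also have "\<dots> \<le> (\<integral>\<^sup>+ S. (\<Sum>\<sigma>\<in>P. \<integral>\<^sup>+ (T, l).
      ennreal (4 / real m * ?w \<sigma> T + 2 * real m * real (length l)) \<partial>hidden_trace m N S a \<sigma>) \<partial>?C)"
  proof (rule nn_integral_mono_AE, rule AE_pmfI)
    fix S assume S: "S \<in> set_pmf (corruption \<delta> n)"
    have "spanning_tree n T" if "\<sigma> permutes {..<n}" "(T, l) \<in> set_pmf (hidden_trace m N S a \<sigma>)" for \<sigma> T l
    proof (rule tree)
      show "\<sigma> \<in> P" using that(1) by (simp add: P_def)
      then show "(T, length l) \<in> set_pmf (outcome \<delta> n A (?I \<sigma>))"
        using that(2) S by (force simp: out)
    qed
    then show "of_nat (card P * card (hidden m N S)) \<le> (\<Sum>\<sigma>\<in>P. \<integral>\<^sup>+ (T, l).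
        ennreal (4 / real m * ?w \<sigma> T + 2 * real m * real (length l)) \<partial>hidden_trace m N S a \<sigma>)"
      unfolding P_def by (rule average_cost_ge[OF m n Nm])
  qed
  also have "\<dots> = (\<Sum>\<sigma>\<in>P. \<integral>\<^sup>+ S. \<integral>\<^sup>+ (T, l).
      ennreal (4 / real m * ?w \<sigma> T + 2 * real m * real (length l)) \<partial>hidden_trace m N S a \<sigma> \<partial>?C)"
    by (simp add: nn_integral_sum)
  also have "\<dots> = (\<Sum>\<sigma>\<in>P. \<integral>\<^sup>+ (T, q). ennreal (4 / real m * ?w \<sigma> T + 2 * real m * real q) \<partial>outcome \<delta> n A (?I \<sigma>))"
    by (intro sum.cong refl) (simp add: out nn_integral_bind_pmf split_def)
  also have "\<dots> \<le> (\<Sum>\<sigma>\<in>P. ?bound \<sigma>)"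
    by (intro sum_mono cost)
  finally have "of_nat (card P) * ennreal (real (N * m) / 4) \<le> (\<Sum>\<sigma>\<in>P. ?bound \<sigma>)" .
  then obtain \<sigma> where "\<sigma> \<in> P" "ennreal (real (N * m) / 4) \<le> ?bound \<sigma>"
    using exists_ge_average_ennreal[OF finP P_ne] by blast
  then show ?thesis
    using hard_instance_metric_weak[OF m Nm, of \<sigma> \<delta>] by (auto simp: P_def)
qed

text \<open>Here \<open>m\<^sup>2\<close> is at most \<open>ln n / 4\<close>, so a pair of blocks is
  fully corrupted with probability \<open>x \<ge> 1 / sqrt n\<close>; then
  \<open>N * x \<ge> 32\<close>, and the exponent in \<open>prob_few_matched_le\<close> is at most
  \<open>- N\<close>.\<close>

lemma prob_many_matched_ge:
  assumes n: "32 * sqrt (ln (real n)) \<le> sqrt (real n)" and s: "4 \<le> sqrt (ln (real n))"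
    and m: "0 < m" "2 * real m \<le> sqrt (ln (real n))" "2 * m \<le> n"
  defines "N \<equiv> n div m"
  shows "1 / 2 \<le> measure_pmf.prob (corruption (1 / 3) n) {S. N \<le> 2 * card (matched N (mate m N S))}"
proof -
  define s where "s = sqrt (ln (real n))"
  define x :: real where "x = (1 / 3) ^ m\<^sup>2"
  have n0: "0 < real n" using m by linarith
  have ss: "s ^ 2 = ln (real n)" "4 \<le> s" using s m by (auto simp: s_def)
  have "(2 * real m)\<^sup>2 \<le> s\<^sup>2" using m by (intro power_mono) (auto simp: s_def)
  then have "2 * real (m\<^sup>2) \<le> ln (real n) / 2" by (simp add: ss power_mult_distrib)
  then have "exp (- (ln (real n) / 2)) \<le> exp (- (2 * real (m\<^sup>2)))" by simp
  also have "\<dots> = exp (- 2) ^ m\<^sup>2" using exp_of_nat_mult[of "m\<^sup>2" "- 2 :: real"] by (simp add: mult.commute)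
  also have "\<dots> \<le> x"
    unfolding x_def using exp_ge_add_one_self[of "2::real"] by (intro power_mono) (auto simp: exp_minus field_simps)
  also have "exp (- (ln (real n) / 2)) = 1 / sqrt (real n)"
    using n0 by (simp add: exp_minus ln_sqrt[symmetric] inverse_eq_divide)
  finally have x: "1 / sqrt (real n) \<le> x" .
  have "2 \<le> N" using m div_le_mono[of "2 * m" n m] by (simp add: N_def)
  have "real n \<le> real N * real m + real m"
    using div_mult_mod_eq[of n m] mod_less_divisor[OF m(1), of n] unfolding N_def
    by (metis add_left_mono less_imp_le of_nat_add of_nat_mono of_nat_mult)
  also have "\<dots> \<le> 2 * real N * real m"
    using \<open>2 \<le> N\<close> mult_right_mono[of 1 "real N" "real m"] by simp
  also have "\<dots> \<le> real N * s"
    using mult_left_mono[OF m(2), of "real N"] by (simp add: s_def mult_ac)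
  finally have N: "real n \<le> real N * s" .
  have "32 * s \<le> real n / sqrt (real n)" using n by (simp add: s_def real_div_sqrt)
  also have "\<dots> \<le> real N * s / sqrt (real n)" using N by (intro divide_right_mono) auto
  finally have "32 * s \<le> real N / sqrt (real n) * s" by simp
  then have "32 \<le> real N / sqrt (real n)"
    by (rule mult_right_le_imp_le) (use ss in simp)
  also have "\<dots> \<le> real N * x" using mult_left_mono[OF x, of "real N"] by simp
  \<comment> \<open>The constant \<open>32\<close> makes \<open>x * (N^2 - 1) / 8\<close>, which is
    at least \<open>x * N^2 / 16\<close>, as large as \<open>2 * N\<close>, twice the term it has to
    beat.\<close>
  finally have "32 * real N \<le> real N * x * real N" by (intro mult_right_mono) auto
  moreover have "real N ^ 2 / 2 \<le> real N ^ 2 - 1"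
    using power_mono[of 2 "real N" 2] \<open>2 \<le> N\<close> by simp
  then have "x * (real N ^ 2 / 2) \<le> x * (real N ^ 2 - 1)"
    by (rule mult_left_mono) (simp add: x_def)
  ultimately have "real N - x * (real N ^ 2 - 1) / 8 \<le> - real N"
    by (simp add: power2_eq_square algebra_simps)
  also have "\<dots> \<le> - 1" using \<open>2 \<le> N\<close> by simp
  finally have "exp (real N - x * (real N ^ 2 - 1) / 8) \<le> exp (- 1)" by simp
  also have "\<dots> \<le> 1 / 2" using exp_ge_add_one_self[of "1::real"] by (simp add: exp_minus field_simps)
  finally have "measure_pmf.prob (corruption (1 / 3) n) {S. 2 * card (matched N (mate m N S)) < N} \<le> 1 / 2"
    using prob_few_matched_le[OF m(1), of "1 / 3" N n] by (simp add: x_def N_def)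
  moreover have "{S. N \<le> 2 * card (matched N (mate m N S))} = UNIV - {S. 2 * card (matched N (mate m N S)) < N}"
    by auto
  ultimately show ?thesis
    using measure_pmf.prob_compl[of "{S. 2 * card (matched N (mate m N S)) < N}" "corruption (1 / 3) n"] by simp
qed

lemma metric_weak_lower_bound:
  "strong_query_lower_bound (1/3) (metric_weak_instances (1/3))
     (\<lambda>n. 1 / 768 * sqrt (ln (real n))) (\<lambda>n. real n / sqrt (ln (real n)))"
proof -
  have ev: "\<forall>\<^sub>F n in sequentially. 32 * sqrt (ln (real n)) \<le> sqrt (real n) \<and>
      4 \<le> sqrt (ln (real n)) \<and> sqrt (ln (real n)) \<le> real n"
    by (intro eventually_conj) real_asymp+
  have "\<exists>I\<in>metric_weak_instances (1/3) n.
      ennreal (1 / 16 * (real n / sqrt (ln (real n)))) \<le> expected_strong_queries (1/3) n A I"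
    if n: "32 * sqrt (ln (real n)) \<le> sqrt (real n)" "4 \<le> sqrt (ln (real n))" "sqrt (ln (real n)) \<le> real n"
      and approx: "\<forall>I\<in>metric_weak_instances (1/3) n. approximates_mst (1/3) n (1 / 768 * sqrt (ln (real n))) A I"
    for n A
  proof -
    define s where "s = sqrt (ln (real n))"
    \<comment> \<open>As \<open>s \<ge> 4\<close>, rounding down keeps \<open>m\<close> between
      \<open>s / 4\<close> and \<open>s / 2\<close>.\<close>
    define m where "m = nat \<lfloor>s / 2\<rfloor>"
    define N where "N = n div m"
    have s: "4 \<le> s" "s \<le> real n" using n by (auto simp: s_def)
    have m: "2 * real m \<le> s" "s \<le> 4 * real m"
      using s unfolding m_def by linarith+
    then have m0: "0 < m" "2 * m \<le> n" "2 \<le> n" using s by linarith+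
    have Nm: "N * m \<le> n" by (simp add: N_def)
    have "real n \<le> real (N * m) + real m"
      using div_mult_mod_eq[of n m] mod_less_divisor[OF m0(1), of n] unfolding N_def
      by (metis add_left_mono less_imp_le of_nat_add of_nat_mono)
    then have half: "real n / 8 \<le> real (N * m) / 4" using m0(2) by linarith
    obtain I where I: "I \<in> metric_weak_instances (1/3) n"
      and le: "ennreal (real (N * m) / 4) \<le> ennreal (4 / real m * (1 / 768 * s * (real n + real m * real (N + 1)))) +
        ennreal (2 * real m) * expected_strong_queries (1/3) n A I"
      using exists_hard_instance[OF m0(1) Nm m0(3), of "1 / 768 * s" "1 / 3" A]
        prob_many_matched_ge[OF n(1,2) m0(1) _ m0(2)] m s approx
      by (auto simp: N_def s_def)
    have "real m * real (N + 1) \<le> 2 * real n"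
      using m0(2) Nm by (simp add: algebra_simps flip: of_nat_mult)
    then have "s * (real n + real m * real (N + 1)) \<le> (4 * real m) * (3 * real n)"
      using m s by (intro mult_mono) auto
    \<comment> \<open>The approximation constant is fixed here:
      \<open>4 * 4 * 3 / 768 = 1 / 16\<close>, half of the \<open>1 / 8\<close> available on the
      left-hand side.\<close>
    then have small: "4 / real m * (1 / 768 * s * (real n + real m * real (N + 1))) \<le> real n / 16"
      using m0(1) by (simp add: field_simps)
    have "ennreal (1 / 16 * (real n / s)) \<le> expected_strong_queries (1/3) n A I"
    proof (cases "expected_strong_queries (1/3) n A I")
      case (real r)
      have "ennreal (real (N * m) / 4) \<le> ennreal (4 / real m * (1 / 768 * s * (real n + real m * real (N + 1))) + 2 * real m * r)"
        using le real s by (simp add: ennreal_plus ennreal_mult)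
      then have "real (N * m) / 4 \<le> 4 / real m * (1 / 768 * s * (real n + real m * real (N + 1))) + 2 * real m * r"
        using real s by (subst (asm) ennreal_le_iff) auto
      then have "real n / 16 \<le> 2 * real m * r" using small half by linarith
      also have "\<dots> \<le> s * r" using m real by (intro mult_right_mono) auto
      finally show ?thesis using real s by (simp add: field_simps ennreal_leI)
    qed simp
    then show ?thesis using I by (auto simp: s_def)
  qed
  then show ?thesis
    unfolding strong_query_lower_bound_def
    by (intro exI[of _ "1 / 16"] conjI eventually_mono[OF ev]) auto
qed

theorem theorem6p2:
  "\<exists>c::real. c > 0 \<and>
     strong_query_lower_bound (1/3) instances
       (\<lambda>n. c * sqrt (ln (real n))) (\<lambda>n. real n / sqrt (ln (real n))) \<and>
     strong_query_lower_bound (1/3) (metric_weak_instances (1/3))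
       (\<lambda>n. c * sqrt (ln (real n))) (\<lambda>n. real n / sqrt (ln (real n)))"
proof (intro exI[of _ "1 / 768"] conjI metric_weak_lower_bound)
  \<comment> \<open>An algorithm that succeeds on the larger class succeeds on the smaller one, and
    the costly instance found there belongs to both.\<close>
  have sub: "metric_weak_instances (1/3) n \<subseteq> instances n" for n
    by (auto simp: metric_weak_instances_def)
  show "strong_query_lower_bound (1/3) instances
      (\<lambda>n. 1 / 768 * sqrt (ln (real n))) (\<lambda>n. real n / sqrt (ln (real n)))"
  proof -
    obtain C :: real where C: "C > 0" and ev: "\<forall>\<^sub>F n in sequentially. \<forall>A.
        (\<forall>I\<in>metric_weak_instances (1/3) n. approximates_mst (1/3) n (1 / 768 * sqrt (ln (real n))) A I) \<longrightarrow>
        (\<exists>I\<in>metric_weak_instances (1/3) n.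
          ennreal (C * (real n / sqrt (ln (real n)))) \<le> expected_strong_queries (1/3) n A I)"
      using metric_weak_lower_bound unfolding strong_query_lower_bound_def by blast
    show ?thesis
      unfolding strong_query_lower_bound_def
      using sub by (intro exI[of _ C] conjI C eventually_mono[OF ev]) blast
  qed
qed simp

end
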